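(* Let $H$ be a real or complex Hilbert space and let $H_1,\dots,H_n$ be closed subspaces of $H$. The following statements are equivalent: (1) the system of subspaces $H_1,\dots,H_n$ possesses the inverse best approximation property (IBAP); (2) the subspaces $H_1,\dots,H_n$ are linearly independent and their sum $H_1+\dots+H_n$ is closed in $H$; (3) $\inf\left\{\dfrac{\|x_1+\dots+x_n\|}{\sqrt{\|x_1\|^2+\dots+\|x_n\|^2}}\ \middle|\ x_1\in H_1,\dots,x_n\in H_n,\ (x_1,\dots,x_n)\neq(0,\dots,0)\right\}>0$; (4) the Gram operator $G=G(H_1,\dots,H_n)$ is an isomorphism; (5) there exist a Hilbert space $K$ and pairwise orthogonal closed subspaces $K_1,\dots,K_n$ of $K$ such that the system $(H;H_1,\dots,H_n)$ is isomorphic to $(K;K_1,\dots,K_n)$; (6) there exists an inner product $\langle\cdot,\cdot\rangle_0$ in $H$ which is equivalent to the original inner product in $H$ and such that the subspaces $H_1,\dots,H_n$ are pairwise orthogonal in $(H;\langle\cdot,\cdot\rangle_0)$; (7) there exist continuous linear projections $E_k:H\to H$, $k=1,\dots,n$, such that $E_iE_j=0$ for every pair $i\neq j$ and $\mathrm{Ran}(E_k)=H_k$ for every $k=1,\dots,n$; (8) $\delta\left(H_i,\sum_{j\neq i}H_j\right)>0$ for every $i=1,\dots,n$; (9) $\sum_{i=1}^n\bigcap_{j\neq i}H_j^\bot=H$; (10) $H_i^\bot+\bigcap_{j\neq i}H_j^\bot=H$ for every $i=1,2,\dots,n$.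
   Context: "Subspace" means linear subset (not necessarily closed). For closed subspaces $H_1,\dots,H_n$ of $H$ let $P_k$ be the orthogonal projection onto $H_k$. The system $H_1,\dots,H_n$ possesses the IBAP if for arbitrary $x_1\in H_1,\dots,x_n\in H_n$ there exists $x\in H$ such that $P_kx=x_k$ for all $k=1,\dots,n$. Subspaces $V_1,\dots,V_n$ of a vector space are linearly independent if $x_1+\dots+x_n=0$ with $x_i\in V_i$ implies $x_1=\dots=x_n=0$. The sum is $V_1+\dots+V_n=\{x_1+\dots+x_n\mid x_i\in V_i\}$. For a nonempty $M\subset H$, $M^\bot=\{x\in H\mid \langle x,y\rangle=0\ \forall y\in M\}$. An isomorphism of Hilbert spaces is a linear bijection that is continuous with continuous inverse. The systems $(H;H_1,\dots,H_n)$ and $(K;K_1,\dots,K_n)$ (Hilbert spaces with closed subspaces) are isomorphic if there is an isomorphism $\varphi:H\to K$ with $\varphi(H_i)=K_i$ for $i=1,\dots,n$. The Gram operator $G(H_1,\dots,H_n):H_1\oplus\dots\oplus H_n\to H_1\oplus\dots\oplus H_n$ (orthogonal direct sum) is defined by the block decomposition $G=(G_{ij})_{i,j=1}^n$, $G_{ij}:=P_i|_{H_j}:H_j\to H_i$. A projection is a linear operator $P$ with $P^2=P$ (not necessarily orthogonal). Two inner products on a vector space are equivalent if the corresponding norms are equivalent. For subspaces $Y,Z$ of a normed space $X$ with $Y\neq\{0\}$, the inclination of $Y$ to $Z$ is $\delta(Y,Z):=\inf\{\mathrm{dist}(y,Z)\mid y\in Y,\|y\|=1\}$, where $\mathrm{dist}(y,Z)=\inf\{\|y-z\|\mid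 z\in Z\}$; if $Y=\{0\}$ then $\delta(Y,Z):=+\infty$. Conventions: the infimum of the empty set is $+\infty$; an empty sum of subspaces is $\{0\}$ and an empty intersection of subspaces of $H$ is $H$. *)

theory Defs
  imports "HOL-Analysis.Analysis"
begin

text \<open>The scalar field of a real or complex Hilbert space. The lemma
  \<open>real_or_complex_dichotomy\<close> below shows that every instance of this class is a copy of
  the reals or of the complex numbers, with the usual conjugation and absolute value.\<close>

class real_or_complex = real_normed_field +
  fixes scalar_cnj :: "'a \<Rightarrow> 'a"
  assumes scalar_cnj_add: "scalar_cnj (a + b) = scalar_cnj a + scalar_cnj b"
    and scalar_cnj_mult: "scalar_cnj (a * b) = scalar_cnj a * scalar_cnj b"
    and scalar_cnj_scaleR_one: "scalar_cnj (r *\<^sub>R 1) = r *\<^sub>R 1"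
    and mult_scalar_cnj_scaleR: "a * scalar_cnj a = (norm a)\<^sup>2 *\<^sub>R 1"

lemma scalar_cnj_of_real: "scalar_cnj (of_real r) = of_real r"
  by (simp add: of_real_def scalar_cnj_scaleR_one)

lemma mult_scalar_cnj: "a * scalar_cnj a = of_real ((norm a)\<^sup>2)"
  by (simp only: of_real_def mult_scalar_cnj_scaleR)

instantiation real :: real_or_complex
begin
definition scalar_cnj_real :: "real \<Rightarrow> real" where "scalar_cnj_real a = a"
instance by standard (simp_all add: scalar_cnj_real_def power2_eq_square)
end

instantiation complex :: real_or_complex
begin
definition scalar_cnj_complex :: "complex \<Rightarrow> complex" where "scalar_cnj_complex = cnj"
instance
proof
  fix a b :: complex and r :: real
  show "a * scalar_cnj a = (norm a)\<^sup>2 *\<^sub>R 1"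
    unfolding scalar_cnj_complex_def scaleR_conv_of_real mult_1_right
    by (rule complex_norm_square [symmetric])
qed (simp_all add: scalar_cnj_complex_def)
end

lemma real_or_complex_dichotomy:
  fixes K :: "'k::real_or_complex itself"
  shows "(UNIV :: 'k set) = range of_real
    \<or> (\<exists>i::'k. i * i = -1 \<and> scalar_cnj i = -i \<and> (\<forall>z. \<exists>a b. z = of_real a + of_real b * i))"
proof (cases "(UNIV :: 'k set) = range of_real")
  case False
  have cnj_minus: "scalar_cnj (- z) = - scalar_cnj z" for z :: 'k
    using scalar_cnj_mult[of "of_real (-1)" z] scalar_cnj_of_real[of "-1", where 'a='k] by simp
  have re: "\<exists>r. z + scalar_cnj z = of_real r" for z :: 'k
  proof -
    have "(1 + z) * scalar_cnj (1 + z) = of_real ((norm (1 + z))\<^sup>2)"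
      by (rule mult_scalar_cnj)
    moreover have "scalar_cnj (1 + z) = 1 + scalar_cnj z"
      using scalar_cnj_add[of 1 z] scalar_cnj_of_real[of 1, where 'a='k] by simp
    ultimately have "z + scalar_cnj z = of_real ((norm (1 + z))\<^sup>2 - 1 - (norm z)\<^sup>2)"
      using mult_scalar_cnj[of z] by (simp add: algebra_simps)
    then show ?thesis by blast
  qed
  obtain z :: 'k where z: "z \<notin> range of_real" using False by blast
  obtain r where r: "z + scalar_cnj z = of_real r" using re by blast
  define w where "w = z - of_real (r / 2)"
  have cw: "scalar_cnj w = - w"
  proof -
    have "scalar_cnj w = scalar_cnj z - of_real (r / 2)"
      using scalar_cnj_add[of z "- of_real (r / 2)"] cnj_minus[of "of_real (r / 2)"]
        scalar_cnj_of_real[of "r / 2", where 'a='k]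
      by (simp add: w_def)
    also have "\<dots> = of_real r - z - of_real (r / 2)" using r by (simp add: algebra_simps)
    also have "\<dots> = - w"
    proof -
      have "(of_real r :: 'k) = of_real (r / 2) + of_real (r / 2)"
        by (metis field_sum_of_halves of_real_add)
      then show ?thesis by (simp add: w_def algebra_simps)
    qed
    finally show ?thesis .
  qed
  have w0: "w \<noteq> 0" using z by (metis w_def eq_iff_diff_eq_0 rangeI)
  define i where "i = of_real (1 / norm w) * w"
  have ci: "scalar_cnj i = - i"
    by (simp only: i_def scalar_cnj_mult scalar_cnj_of_real cw) simp
  have ni: "norm i = 1" using w0 by (simp add: i_def norm_divide)
  have ii: "i * i = -1"
  proof -
    have "- (i * i) = 1" using mult_scalar_cnj[of i] ci ni by simp
    then show ?thesis by (metis minus_minus)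
  qed
  have dec: "\<exists>a b. y = of_real a + of_real b * i" for y :: 'k
  proof -
    obtain a where a: "y + scalar_cnj y = of_real a" using re by blast
    have yi: "scalar_cnj (y * i) = - (scalar_cnj y * i)"
      by (simp add: scalar_cnj_mult ci)
    obtain b where b: "y * i + scalar_cnj (y * i) = of_real b" using re by blast
    have "y * i - scalar_cnj y * i = of_real b" using b yi by simp
    then have "(y * i - scalar_cnj y * i) * i = of_real b * i" by simp
    moreover have "(y * i - scalar_cnj y * i) * i = (y - scalar_cnj y) * (i * i)"
      by (simp add: algebra_simps)
    ultimately have "scalar_cnj y - y = of_real b * i" using ii by simp
    then have "2 * y = of_real a - of_real b * i" using a by (simp add: algebra_simps)
    then have "y = of_real (a / 2) + of_real (- b / 2) * i" by (simp add: field_simps)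
    then show ?thesis by blast
  qed
  show ?thesis using ii ci dec by blast
qed simp


text \<open>Inner products are explicit functions rather than type class operations, since the
  statement compares several Hilbert space structures. They are linear in the first argument.\<close>

locale inner_product_space = vector_space smul
  for smul :: "'k::real_or_complex \<Rightarrow> 'a::ab_group_add \<Rightarrow> 'a" +
  fixes ip :: "'a \<Rightarrow> 'a \<Rightarrow> 'k"
  assumes ip_add_left: "ip (x + y) z = ip x z + ip y z"
    and ip_scale_left: "ip (smul c x) y = c * ip x y"
    and ip_cnj: "ip y x = scalar_cnj (ip x y)"
    and ip_pos: "x \<noteq> 0 \<Longrightarrow> \<exists>r>0. ip x x = of_real r"

definition ip_norm :: "('a \<Rightarrow> 'a \<Rightarrow> 'k::real_or_complex) \<Rightarrow> 'a \<Rightarrow> real" where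
  "ip_norm ip x = sqrt (norm (ip x x))"

definition ip_dist ::
    "('a \<Rightarrow> 'a \<Rightarrow> 'k::real_or_complex) \<Rightarrow> 'a::ab_group_add \<Rightarrow> 'a \<Rightarrow> real" where
  "ip_dist ip x y = ip_norm ip (x - y)"

abbreviation ip_topology ::
    "('a \<Rightarrow> 'a \<Rightarrow> 'k::real_or_complex) \<Rightarrow> 'a::ab_group_add topology" where
  "ip_topology ip \<equiv> Metric_space.mtopology UNIV (ip_dist ip)"

locale hilbert_space = inner_product_space smul ip
  for smul :: "'k::real_or_complex \<Rightarrow> 'a::ab_group_add \<Rightarrow> 'a" and ip :: "'a \<Rightarrow> 'a \<Rightarrow> 'k" +
  assumes complete: "Metric_space.mcomplete UNIV (ip_dist ip)"

definition closed_subspace ::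
    "('k::real_or_complex \<Rightarrow> 'a::ab_group_add \<Rightarrow> 'a) \<Rightarrow> ('a \<Rightarrow> 'a \<Rightarrow> 'k) \<Rightarrow> 'a set \<Rightarrow> bool" where
  "closed_subspace smul ip S \<longleftrightarrow> module.subspace smul S \<and> closedin (ip_topology ip) S"

definition orth_compl ::
    "('a \<Rightarrow> 'a \<Rightarrow> 'k::real_or_complex) \<Rightarrow> 'a set \<Rightarrow> 'a set" where
  "orth_compl ip M = {x. \<forall>y\<in>M. ip x y = 0}"

definition pairwise_orthogonal ::
    "('a \<Rightarrow> 'a \<Rightarrow> 'k::real_or_complex) \<Rightarrow> ('n \<Rightarrow> 'a set) \<Rightarrow> bool" where
  "pairwise_orthogonal ip H \<longleftrightarrow> (\<forall>i j. i \<noteq> j \<longrightarrow> (\<forall>x\<in>H i. \<forall>y\<in>H j. ip x y = 0))"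

definition orth_proj ::
    "('a \<Rightarrow> 'a \<Rightarrow> 'k::real_or_complex) \<Rightarrow> 'a::ab_group_add set \<Rightarrow> 'a \<Rightarrow> 'a" where
  "orth_proj ip S x = (THE y. y \<in> S \<and> x - y \<in> orth_compl ip S)"

definition IBAP ::
    "('a \<Rightarrow> 'a \<Rightarrow> 'k::real_or_complex) \<Rightarrow> ('n \<Rightarrow> 'a::ab_group_add set) \<Rightarrow> bool" where
  "IBAP ip H \<longleftrightarrow>
    (\<forall>x. (\<forall>k. x k \<in> H k) \<longrightarrow> (\<exists>y. \<forall>k. orth_proj ip (H k) y = x k))"

definition lin_independent_subspaces :: "('n::finite \<Rightarrow> 'a::ab_group_add set) \<Rightarrow> bool" where
  "lin_independent_subspaces H \<longleftrightarrow>
    (\<forall>x. (\<forall>i. x i \<in> H i) \<and> (\<Sum>i\<in>UNIV. x i) = 0 \<longrightarrow> (\<forall>i. x i = 0))"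

text \<open>Isomorphism between linear subspaces \<open>V\<close>, \<open>W\<close> with the inherited inner products;
  whole spaces are the case \<open>V = UNIV\<close>, \<open>W = UNIV\<close>.\<close>

definition hilbert_isomorphism ::
    "('k::real_or_complex \<Rightarrow> 'a::ab_group_add \<Rightarrow> 'a) \<Rightarrow> ('a \<Rightarrow> 'a \<Rightarrow> 'k) \<Rightarrow> 'a set \<Rightarrow>
     ('k \<Rightarrow> 'b::ab_group_add \<Rightarrow> 'b) \<Rightarrow> ('b \<Rightarrow> 'b \<Rightarrow> 'k) \<Rightarrow> 'b set \<Rightarrow> ('a \<Rightarrow> 'b) \<Rightarrow> bool" where
  "hilbert_isomorphism scale1 ip1 V scale2 ip2 W f \<longleftrightarrow>
    (\<forall>x\<in>V. \<forall>y\<in>V. f (x + y) = f x + f y) \<and>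
    (\<forall>c. \<forall>x\<in>V. f (scale1 c x) = scale2 c (f x)) \<and>
    bij_betw f V W \<and>
    continuous_map (subtopology (ip_topology ip1) V) (subtopology (ip_topology ip2) W) f \<and>
    continuous_map (subtopology (ip_topology ip2) W) (subtopology (ip_topology ip1) V)
      (inv_into V f)"

definition isomorphic_systems ::
    "('k::real_or_complex \<Rightarrow> 'a::ab_group_add \<Rightarrow> 'a) \<Rightarrow> ('a \<Rightarrow> 'a \<Rightarrow> 'k) \<Rightarrow> ('n \<Rightarrow> 'a set) \<Rightarrow>
     ('k \<Rightarrow> 'b::ab_group_add \<Rightarrow> 'b) \<Rightarrow> ('b \<Rightarrow> 'b \<Rightarrow> 'k) \<Rightarrow> ('n \<Rightarrow> 'b set) \<Rightarrow> bool" where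
  "isomorphic_systems scale1 ip1 H scale2 ip2 K \<longleftrightarrow>
    (\<exists>f. hilbert_isomorphism scale1 ip1 UNIV scale2 ip2 UNIV f \<and> (\<forall>i. f ` H i = K i))"

text \<open>HOL cannot quantify existentially over types, so the type \<open>'b\<close> carrying the Hilbert
  space \<open>K\<close> is a parameter. Its linear structure and inner product are existentially quantified.\<close>

definition isomorphic_to_orthogonal_system ::
    "'b::ab_group_add itself \<Rightarrow>
     ('k::real_or_complex \<Rightarrow> 'a::ab_group_add \<Rightarrow> 'a) \<Rightarrow> ('a \<Rightarrow> 'a \<Rightarrow> 'k) \<Rightarrow> ('n \<Rightarrow> 'a set) \<Rightarrow> bool" where
  "isomorphic_to_orthogonal_system K_type smul ip H \<longleftrightarrow>
    (\<exists>(scaleK :: 'k \<Rightarrow> 'b \<Rightarrow> 'b) ipK K.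
      hilbert_space scaleK ipK \<and>
      (\<forall>i. closed_subspace scaleK ipK (K i)) \<and>
      pairwise_orthogonal ipK K \<and>
      isomorphic_systems smul ip H scaleK ipK K)"

text \<open>The orthogonal direct sum of the \<open>H i\<close> is the subspace \<open>direct_sum H\<close> of \<open>'a ^ 'n\<close>
  with componentwise scalar multiplication \<open>dsum_scale\<close> and inner product \<open>dsum_ip\<close>.\<close>

definition direct_sum :: "('n::finite \<Rightarrow> 'a set) \<Rightarrow> ('a ^ 'n) set" where
  "direct_sum H = {x. \<forall>i. x $ i \<in> H i}"

definition dsum_scale :: "('k \<Rightarrow> 'a \<Rightarrow> 'a) \<Rightarrow> 'k \<Rightarrow> 'a ^ 'n::finite \<Rightarrow> 'a ^ 'n" where
  "dsum_scale smul c x = (\<chi> i. smul c (x $ i))"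

definition dsum_ip ::
    "('a \<Rightarrow> 'a \<Rightarrow> 'k::real_or_complex) \<Rightarrow> 'a ^ 'n::finite \<Rightarrow> 'a ^ 'n \<Rightarrow> 'k" where
  "dsum_ip ip x y = (\<Sum>i\<in>UNIV. ip (x $ i) (y $ i))"

text \<open>The block with indices \<open>i\<close>, \<open>j\<close> is the restriction of \<open>orth_proj ip (H i)\<close> to \<open>H j\<close>;
  the operator is only meaningful on \<open>direct_sum H\<close>.\<close>

definition gram_operator ::
    "('a \<Rightarrow> 'a \<Rightarrow> 'k::real_or_complex) \<Rightarrow> ('n::finite \<Rightarrow> 'a::ab_group_add set) \<Rightarrow>
     'a ^ 'n \<Rightarrow> 'a ^ 'n" where
  "gram_operator ip H x = (\<chi> i. \<Sum>j\<in>UNIV. orth_proj ip (H i) (x $ j))"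

definition equivalent_inner_products ::
    "('a \<Rightarrow> 'a \<Rightarrow> 'k::real_or_complex) \<Rightarrow> ('a \<Rightarrow> 'a \<Rightarrow> 'k) \<Rightarrow> bool" where
  "equivalent_inner_products ip1 ip2 \<longleftrightarrow>
    (\<exists>c>0. \<exists>C>0. \<forall>x. c * ip_norm ip1 x \<le> ip_norm ip2 x \<and> ip_norm ip2 x \<le> C * ip_norm ip1 x)"

definition continuous_projection ::
    "('k::real_or_complex \<Rightarrow> 'a::ab_group_add \<Rightarrow> 'a) \<Rightarrow> ('a \<Rightarrow> 'a \<Rightarrow> 'k) \<Rightarrow> ('a \<Rightarrow> 'a) \<Rightarrow> bool" where
  "continuous_projection smul ip E \<longleftrightarrow>
    Vector_Spaces.linear smul smul E \<and>
    continuous_map (ip_topology ip) (ip_topology ip) E \<and> E \<circ> E = E"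

definition dist_to_set ::
    "('a \<Rightarrow> 'a \<Rightarrow> 'k::real_or_complex) \<Rightarrow> 'a::ab_group_add \<Rightarrow> 'a set \<Rightarrow> ereal" where
  "dist_to_set ip y Z = Inf {ereal (ip_norm ip (y - z)) | z. z \<in> Z}"

definition inclination ::
    "('a \<Rightarrow> 'a \<Rightarrow> 'k::real_or_complex) \<Rightarrow> 'a::ab_group_add set \<Rightarrow> 'a set \<Rightarrow> ereal" where
  "inclination ip Y Z =
    (if Y = {0} then \<infinity> else Inf {dist_to_set ip y Z | y. y \<in> Y \<and> ip_norm ip y = 1})"

definition all_equivalent :: "bool list \<Rightarrow> bool" where
  "all_equivalent Ps \<longleftrightarrow> (\<forall>P\<in>set Ps. \<forall>Q\<in>set Ps. P \<longleftrightarrow> Q)"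

end

theory Submission
  imports Defs
begin

text \<open>Everything is measured by the \<^emph>\<open>summation map\<close> that sends a tuple in the orthogonal direct
  sum of the \<open>H i\<close> to the sum of its entries. Its adjoint is the map sending \<open>y\<close> to the tuple of
  its orthogonal projections, and composing the adjoint with the summation map gives the Gram
  operator. The statements say the same thing in different words: the summation map is bounded
  below (\<open>sum_bounded_below\<close>), or equivalently its adjoint is onto, which is the IBAP.

  Most passages are elementary. Solving the interpolation problem for tuples with one nonzero entry
  decomposes the space by annihilators, and conversely these decompositions yield solutions for such
  tuples, which are then added up. Positivity of the inclinations bounds every summand by the sum,
  hence the summation map from below. A bounded-below summation map is injective with closed range,
  and the components of a sum are bounded functions of it; composing them with the orthogonal
  projection onto the closed sum gives the projections \<open>E k\<close>. Adding the pullbacks of the inner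
  product along the \<open>E k\<close> and along the complementary projection makes the subspaces orthogonal, and
  the identity map is then the isomorphism onto an orthogonal system. An isomorphism onto an
  orthogonal system carries the bound \<open>\<parallel>f (x i)\<parallel> \<le> \<parallel>\<Sum>j. f (x j)\<parallel>\<close> back.

  Two passages rest on Baire's theorem. Both use the uniform boundedness principle in the form that
  a weakly bounded family of vectors is norm bounded (\<open>uniform_boundedness_family\<close>):
  \<^item> if the annihilators of \<open>H i\<close> and of the other subspaces add up to the whole space, then every
    vector \<open>h\<close> splits as \<open>u + v\<close> and \<open>\<langle>y, h\<rangle> = \<langle>y - z, v\<rangle>\<close> for \<open>y\<close> in \<open>H i\<close> and \<open>z\<close> in the sum of the others,
    so \<open>\<parallel>y\<parallel> \<le> C \<parallel>y - z\<parallel>\<close>, a positive inclination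
    (\<open>complement_imp_inclination_pos\<close>);
  \<^item> if the sum is closed and direct, testing against elements of the sum shows that the adjoint of
    the summation map is bounded below on the sum; its range is closed and, by independence, dense
    in the direct sum, so the adjoint is onto (\<open>independent_closed_imp_IBAP\<close>).

  The same closed and dense range argument shows that a bounded-below summation map has an
  invertible Gram operator, since the quadratic form of the latter is \<open>\<parallel>\<Sum>i. x i\<parallel>\<^sup>2\<close>.\<close>

section \<open>Inner products and their norms\<close>

lemma norm_scalar_cnj: "norm (scalar_cnj a) = norm (a :: 'k::real_or_complex)"
proof (cases "a = 0")
  case True
  then show ?thesis using scalar_cnj_of_real[of 0, where 'a='k] by simp
next
  case False
  have "norm a * norm (scalar_cnj a) = norm a * norm a"
    using arg_cong[OF mult_scalar_cnj[of a], of norm]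
    by (simp add: norm_mult power2_eq_square)
  then show ?thesis using False by simp
qed

lemma scalar_cnj_zero [simp]: "scalar_cnj (0 :: 'k::real_or_complex) = 0"
  using scalar_cnj_of_real[of 0, where 'a='k] by simp

lemma scalar_cnj_sum: "scalar_cnj (sum f A) = (\<Sum>a\<in>A. scalar_cnj (f a :: 'k::real_or_complex))"
  by (induction A rule: infinite_finite_induct) (simp_all add: scalar_cnj_add)

context inner_product_space
begin

abbreviation nrm :: "'a \<Rightarrow> real" where "nrm \<equiv> ip_norm ip"

lemma ip_zero_left [simp]: "ip 0 y = 0"
  using ip_scale_left[of 0 0 y] by simp

lemma ip_zero_right [simp]: "ip x 0 = 0"
  using ip_cnj[of x 0] by simp

lemma ip_minus_left: "ip (- x) y = - ip x y"
  using ip_scale_left[of "-1" x y] by simp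

lemma ip_diff_left: "ip (x - y) z = ip x z - ip y z"
  using ip_add_left[of x "- y" z] by (simp add: ip_minus_left)

lemma ip_add_right: "ip x (y + z) = ip x y + ip x z"
  using ip_cnj[of x "y + z"] ip_cnj[of x y] ip_cnj[of x z] by (simp add: ip_add_left scalar_cnj_add)

lemma ip_scale_right: "ip x (smul c y) = scalar_cnj c * ip x y"
  using ip_cnj[of x "smul c y"] ip_cnj[of x y] by (simp add: ip_scale_left scalar_cnj_mult)

lemma ip_diff_right: "ip x (y - z) = ip x y - ip x z"
  using ip_add_right[of x "y - z" z] by simp

lemma ip_sum_left: "ip (sum f A) y = (\<Sum>a\<in>A. ip (f a) y)"
  by (induction A rule: infinite_finite_induct) (simp_all add: ip_add_left)

lemma ip_sum_right: "ip x (sum f A) = (\<Sum>a\<in>A. ip x (f a))"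
  by (induction A rule: infinite_finite_induct) (simp_all add: ip_add_right)

lemma ip_eq_0_commute: "ip x y = 0 \<longleftrightarrow> ip y x = 0"
  by (metis ip_cnj scalar_cnj_zero)

lemma nrm_nonneg [simp]: "0 \<le> nrm x"
  by (simp add: ip_norm_def)

lemma ip_self: "ip x x = of_real ((nrm x)\<^sup>2)"
proof (cases "x = 0")
  case False
  then obtain r where "r > 0" "ip x x = of_real r" using ip_pos by blast
  then show ?thesis by (simp add: ip_norm_def)
qed (simp add: ip_norm_def)

lemma norm_ip_self: "norm (ip x x) = (nrm x)\<^sup>2"
  by (simp add: ip_norm_def)

lemma nrm_zero [simp]: "nrm 0 = 0"
  by (simp add: ip_norm_def)

lemma nrm_eq_0_iff [simp]: "nrm x = 0 \<longleftrightarrow> x = 0"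
proof (cases "x = 0")
  case False
  then show ?thesis using ip_pos[of x] by (auto simp: ip_norm_def)
qed simp

lemma nrm_pos: "x \<noteq> 0 \<Longrightarrow> 0 < nrm x"
  using nrm_eq_0_iff[of x] nrm_nonneg[of x] by linarith

lemma nrm_scale: "nrm (smul c x) = norm c * nrm x"
  by (simp add: ip_norm_def ip_scale_left ip_scale_right norm_mult norm_scalar_cnj
      real_sqrt_mult mult.assoc[symmetric])

lemma nrm_minus: "nrm (- x) = nrm x"
  using nrm_scale[of "-1" x] by simp

lemma nrm_minus_commute: "nrm (x - y) = nrm (y - x)"
  using nrm_minus[of "x - y"] by simp

lemma nrm_sq_add_orthogonal:
  assumes "ip x y = 0"
  shows "(nrm (x + y))\<^sup>2 = (nrm x)\<^sup>2 + (nrm y)\<^sup>2"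
proof -
  have "ip y x = 0" using assms ip_eq_0_commute by blast
  then have "ip (x + y) (x + y) = ip x x + ip y y"
    using assms by (simp add: ip_add_left ip_add_right)
  then have "(of_real ((nrm (x + y))\<^sup>2) :: 'k) = of_real ((nrm x)\<^sup>2 + (nrm y)\<^sup>2)"
    by (simp only: ip_self of_real_add)
  then show ?thesis by (simp only: of_real_eq_iff)
qed

lemma parallelogram: "(nrm (x + y))\<^sup>2 + (nrm (x - y))\<^sup>2 = 2 * (nrm x)\<^sup>2 + 2 * (nrm y)\<^sup>2"
proof -
  have "ip (x + y) (x + y) + ip (x - y) (x - y) = 2 * ip x x + 2 * ip y y"
    by (simp add: ip_add_left ip_add_right ip_diff_left ip_diff_right)
  then have "(of_real ((nrm (x + y))\<^sup>2 + (nrm (x - y))\<^sup>2) :: 'k)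
      = of_real (2 * (nrm x)\<^sup>2 + 2 * (nrm y)\<^sup>2)"
    by (simp only: ip_self of_real_add of_real_mult of_real_numeral)
  then show ?thesis by (simp only: of_real_eq_iff)
qed

text \<open>Subtracting from \<open>x\<close> its component along \<open>y\<close> shortens it by exactly that component. As the result is
  nonnegative, this gives the Cauchy--Schwarz inequality; and if \<open>x\<close> is the error of a best approximation
  by a subspace containing \<open>y\<close>, it cannot be shortened, so it is orthogonal to \<open>y\<close>.\<close>

lemma nrm_sq_minus_component:
  assumes "y \<noteq> 0"
  shows "(nrm (x - smul (ip x y / ip y y) y))\<^sup>2 = (nrm x)\<^sup>2 - (norm (ip x y) / nrm y)\<^sup>2"
proof -
  define c where "c = ip x y / ip y y"
  have yy: "ip y y \<noteq> 0" using assms by (simp add: ip_self)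
  then have "ip (x - smul c y) (smul c y) = 0"
    by (simp add: ip_diff_left ip_scale_left ip_scale_right c_def)
  from nrm_sq_add_orthogonal[OF this]
  have "(nrm x)\<^sup>2 = (nrm (x - smul c y))\<^sup>2 + (norm c * nrm y)\<^sup>2"
    by (simp add: nrm_scale)
  moreover have "norm c * nrm y = norm (ip x y) / nrm y"
    using assms by (simp add: c_def ip_self norm_divide power2_eq_square norm_mult)
  ultimately show ?thesis by (simp add: c_def)
qed

lemma Cauchy_Schwarz: "norm (ip x y) \<le> nrm x * nrm y"
proof (cases "y = 0")
  case False
  then have pos: "nrm y > 0" by (rule nrm_pos)
  have "(norm (ip x y) / nrm y)\<^sup>2 \<le> (nrm x)\<^sup>2"
    using nrm_sq_minus_component[OF False, of x]
      zero_le_power2[of "nrm (x - smul (ip x y / ip y y) y)"] by linarith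
  then have "norm (ip x y) / nrm y \<le> nrm x"
    by (rule power2_le_imp_le) simp
  then show ?thesis using pos by (simp add: field_simps)
qed simp

lemma nrm_triangle: "nrm (x + y) \<le> nrm x + nrm y"
proof (rule power2_le_imp_le)
  have "(nrm (x + y))\<^sup>2 = norm (ip (x + y) (x + y))" by (simp add: norm_ip_self)
  also have "\<dots> = norm (ip x x + ip x y + (ip y x + ip y y))"
    by (simp add: ip_add_left ip_add_right algebra_simps)
  also have "\<dots> \<le> norm (ip x x) + norm (ip x y) + (norm (ip y x) + norm (ip y y))"
    by (intro norm_triangle_mono order_refl)
  also have "\<dots> \<le> (nrm x)\<^sup>2 + nrm x * nrm y + (nrm y * nrm x + (nrm y)\<^sup>2)"
    using Cauchy_Schwarz[of x y] Cauchy_Schwarz[of y x]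
    unfolding norm_ip_self by linarith
  also have "\<dots> = (nrm x + nrm y)\<^sup>2" by (simp add: power2_eq_square algebra_simps)
  finally show "(nrm (x + y))\<^sup>2 \<le> (nrm x + nrm y)\<^sup>2" .
qed simp

lemma nrm_triangle_diff: "nrm (x - z) \<le> nrm (x - y) + nrm (y - z)"
  using nrm_triangle[of "x - y" "y - z"] by simp

lemma nrm_sum_le: "nrm (sum f A) \<le> (\<Sum>a\<in>A. nrm (f a))"
proof (induction A rule: infinite_finite_induct)
  case (insert a A)
  then show ?case using nrm_triangle[of "f a" "sum f A"] by simp
qed simp_all

section \<open>Convergence, closedness and completeness in terms of the norm\<close>

lemma Metric_space_ip_dist: "Metric_space UNIV (ip_dist ip)"
proof
  fix x y z :: 'a
  show "0 \<le> ip_dist ip x y" "ip_dist ip x y = ip_dist ip y x"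
    by (simp_all add: ip_dist_def nrm_minus_commute)
  show "ip_dist ip x y = 0 \<longleftrightarrow> x = y" by (simp add: ip_dist_def)
  show "ip_dist ip x z \<le> ip_dist ip x y + ip_dist ip y z"
    by (simp add: ip_dist_def nrm_triangle_diff)
qed

lemma limitin_iff_nrm:
  "limitin (ip_topology ip) f l sequentially \<longleftrightarrow> (\<lambda>n. nrm (f n - l)) \<longlonglongrightarrow> 0"
  by (simp add: Metric_space.limit_metric_sequentially[OF Metric_space_ip_dist] LIMSEQ_iff ip_dist_def)

lemma closedin_iff_nrm:
  "closedin (ip_topology ip) S \<longleftrightarrow>
    (\<forall>f l. (\<forall>n. f n \<in> S) \<and> (\<lambda>n. nrm (f n - l)) \<longlonglongrightarrow> 0 \<longrightarrow> l \<in> S)"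
  by (simp add: Metric_space.metric_closedin_iff_sequentially_closed[OF Metric_space_ip_dist]
      limitin_iff_nrm image_subset_iff)

definition cauchy_seq :: "(nat \<Rightarrow> 'a) \<Rightarrow> bool" where
  "cauchy_seq f \<longleftrightarrow> (\<forall>e>0. \<exists>M. \<forall>m\<ge>M. \<forall>n\<ge>M. nrm (f m - f n) < e)"

lemma mcomplete_iff_nrm:
  "Metric_space.mcomplete UNIV (ip_dist ip) \<longleftrightarrow>
    (\<forall>f. cauchy_seq f \<longrightarrow> (\<exists>l. (\<lambda>n. nrm (f n - l)) \<longlonglongrightarrow> 0))"
  by (simp add: Metric_space.mcomplete_def[OF Metric_space_ip_dist]
      Metric_space.MCauchy_def[OF Metric_space_ip_dist] limitin_iff_nrm cauchy_seq_def ip_dist_def)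

lemma cauchy_seq_of_convergent:
  assumes "(\<lambda>n. nrm (f n - l)) \<longlonglongrightarrow> 0"
  shows "cauchy_seq f"
  unfolding cauchy_seq_def
proof (intro allI impI)
  fix e :: real assume "e > 0"
  then obtain M where M: "\<And>n. n \<ge> M \<Longrightarrow> nrm (f n - l) < e / 2"
    using assms unfolding LIMSEQ_iff by (metis abs_of_nonneg diff_zero half_gt_zero nrm_nonneg real_norm_def)
  have "nrm (f m - f n) < e" if "m \<ge> M" "n \<ge> M" for m n
    using nrm_triangle_diff[of "f m" "f n" l] M[OF that(1)] M[OF that(2)] nrm_minus_commute[of "f n" l]
    by linarith
  then show "\<exists>M. \<forall>m\<ge>M. \<forall>n\<ge>M. nrm (f m - f n) < e" by blast
qed

lemma limit_unique:
  assumes "(\<lambda>n. nrm (f n - l)) \<longlonglongrightarrow> 0" "(\<lambda>n. nrm (f n - l')) \<longlonglongrightarrow> 0"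
  shows "l = l'"
  using Metric_space.limitin_metric_unique[OF Metric_space_ip_dist] assms
  unfolding limitin_iff_nrm[symmetric] by (metis trivial_limit_sequentially)

lemma closed_subspaceD:
  assumes "closed_subspace smul ip S"
  shows "subspace S" "\<And>f l. (\<And>n. f n \<in> S) \<Longrightarrow> (\<lambda>n. nrm (f n - l)) \<longlonglongrightarrow> 0 \<Longrightarrow> l \<in> S"
  using assms unfolding closed_subspace_def closedin_iff_nrm by blast+

end

context hilbert_space
begin

lemma cauchy_seq_converges:
  assumes "cauchy_seq f"
  obtains l where "(\<lambda>n. nrm (f n - l)) \<longlonglongrightarrow> 0"
  using assms complete unfolding mcomplete_iff_nrm by blast

end

lemma hilbert_spaceI:
  assumes "inner_product_space smul ip"
    and "\<And>f. inner_product_space.cauchy_seq ip f \<Longrightarrow> \<exists>l. (\<lambda>n. ip_norm ip (f n - l)) \<longlonglongrightarrow> 0"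
  shows "hilbert_space smul ip"
proof -
  interpret inner_product_space smul ip by fact
  show ?thesis
    by unfold_locales (use assms(2) in \<open>simp add: mcomplete_iff_nrm\<close>)
qed

section \<open>Continuity of linear maps\<close>

text \<open>A continuous linear map is bounded by \<open>1\<close> on a small ball around \<open>0\<close>, and scaling spreads this bound to
  \<open>V\<close>. Additivity and homogeneity are required on \<open>V\<close> only, because inverses of isomorphisms
  between subspaces are linear only there.\<close>

lemma continuous_linear_iff_bounded:
  fixes V :: "'a::ab_group_add set" and W :: "'b::ab_group_add set"
  assumes ips1: "inner_product_space s1 ip1" and ips2: "inner_product_space s2 ip2"
    and V: "module.subspace s1 V"
    and add: "\<And>x y. x \<in> V \<Longrightarrow> y \<in> V \<Longrightarrow> f (x + y) = f x + f y"
    and hom: "\<And>c x. x \<in> V \<Longrightarrow> f (s1 c x) = s2 c (f x)"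
    and fW: "f ` V \<subseteq> W"
  shows "continuous_map (subtopology (ip_topology ip1) V) (subtopology (ip_topology ip2) W) f
    \<longleftrightarrow> (\<exists>C. \<forall>x\<in>V. ip_norm ip2 (f x) \<le> C * ip_norm ip1 x)" (is "?L \<longleftrightarrow> ?R")
proof -
  interpret X: inner_product_space s1 ip1 by fact
  interpret Y: inner_product_space s2 ip2 by fact
  interpret MX: Metric_space UNIV "ip_dist ip1" by (rule X.Metric_space_ip_dist)
  interpret MY: Metric_space UNIV "ip_dist ip2" by (rule Y.Metric_space_ip_dist)
  interpret SX: Submetric UNIV "ip_dist ip1" V by unfold_locales simp
  have f0: "f 0 = 0" using hom[of 0 0] X.subspace_0[OF V] by simp
  have fdiff: "f (x - y) = f x - f y" if "x \<in> V" "y \<in> V" for x y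
    using add[of "x - y" y] X.subspace_diff[OF V that] that by (simp add: algebra_simps)
  have cm: "?L \<longleftrightarrow> continuous_map (subtopology (ip_topology ip1) V) (ip_topology ip2) f"
    using fW by (auto simp: continuous_map_in_subtopology)
  show ?thesis
  proof
    assume ?L
    then have "openin (subtopology (ip_topology ip1) V)
        {x \<in> topspace (subtopology (ip_topology ip1) V). f x \<in> MY.mball 0 1}"
      unfolding cm by (intro openin_continuous_map_preimage) auto
    then have op: "openin SX.sub.mtopology {x \<in> V. f x \<in> MY.mball 0 1}"
      by (simp add: SX.mtopology_submetric)
    have "0 \<in> {x \<in> V. f x \<in> MY.mball 0 1}"
      using X.subspace_0[OF V] by (simp add: f0)
    with op obtain r where r: "r > 0" "SX.sub.mball 0 r \<subseteq> {x \<in> V. f x \<in> MY.mball 0 1}"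
      unfolding SX.sub.openin_mtopology by blast
    have small: "ip_norm ip2 (f x) < 1" if "x \<in> V" "ip_norm ip1 x < r" for x
    proof -
      have "x \<in> SX.sub.mball 0 r"
        using that X.subspace_0[OF V] X.nrm_minus_commute[of 0 x] by (simp add: ip_dist_def)
      then show ?thesis using r(2) Y.nrm_minus_commute[of 0 "f x"] by (auto simp: ip_dist_def)
    qed
    have "ip_norm ip2 (f x) \<le> (2 / r) * ip_norm ip1 x" if x: "x \<in> V" for x
    proof (cases "x = 0")
      case False
      define t where "t = r / (2 * ip_norm ip1 x)"
      have p: "ip_norm ip1 x > 0" using False by (rule X.nrm_pos)
      have t: "t > 0" using p r by (simp add: t_def)
      have "ip_norm ip2 (f (s1 (of_real t) x)) < 1"
      proof (rule small)
        show "s1 (of_real t) x \<in> V" by (rule X.subspace_scale[OF V x])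
        show "ip_norm ip1 (s1 (of_real t) x) < r"
          using p r t by (simp add: X.nrm_scale) (simp add: t_def)
      qed
      then have "t * ip_norm ip2 (f x) < 1"
        using t by (simp add: hom[OF x] Y.nrm_scale)
      then show ?thesis using p r by (simp add: t_def field_simps)
    qed (simp add: f0)
    then show ?R by blast
  next
    assume ?R
    then obtain C0 where C0: "\<And>x. x \<in> V \<Longrightarrow> ip_norm ip2 (f x) \<le> C0 * ip_norm ip1 x" by blast
    define C where "C = max C0 1"
    have C: "C > 0" and Cb: "\<And>x. x \<in> V \<Longrightarrow> ip_norm ip2 (f x) \<le> C * ip_norm ip1 x"
      using C0 by (auto simp: C_def) (meson X.nrm_nonneg max.cobounded1 mult_right_mono order_trans)
    have "openin SX.sub.mtopology {x \<in> V. f x \<in> U}" if U: "openin (ip_topology ip2) U" for U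
      unfolding SX.sub.openin_mtopology
    proof (intro conjI allI impI)
      fix x assume x: "x \<in> {x \<in> V. f x \<in> U}"
      then obtain e where e: "e > 0" "MY.mball (f x) e \<subseteq> U"
        using U unfolding MY.openin_mtopology by blast
      have "SX.sub.mball x (e / C) \<subseteq> {x \<in> V. f x \<in> U}"
      proof
        fix y assume y: "y \<in> SX.sub.mball x (e / C)"
        then have yV: "y \<in> V" and d: "ip_norm ip1 (x - y) < e / C" by (auto simp: ip_dist_def)
        have "ip_norm ip2 (f x - f y) \<le> C * ip_norm ip1 (x - y)"
          using Cb[of "x - y"] x yV X.subspace_diff[OF V] by (simp add: fdiff)
        also have "\<dots> < e" using d C by (simp add: field_simps)
        finally show "y \<in> {x \<in> V. f x \<in> U}" using e(2) yV by (auto simp: ip_dist_def)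
      qed
      then show "\<exists>r>0. SX.sub.mball x r \<subseteq> {x \<in> V. f x \<in> U}" using e(1) C by (meson divide_pos_pos)
    qed auto
    then show ?L unfolding cm
      by (simp add: continuous_map_def SX.mtopology_submetric[symmetric])
  qed
qed

section \<open>Orthogonal projections\<close>

context hilbert_space
begin

text \<open>The parallelogram law forces every minimising sequence for the distance from \<open>x\<close> to \<open>S\<close> to be Cauchy,
  and its limit is a nearest point; moving from it along any \<open>z\<close> in \<open>S\<close> cannot shorten the error, so
  the error is orthogonal to \<open>S\<close>.\<close>

lemma orthogonal_decomposition_exists:
  assumes S: "closed_subspace smul ip S"
  shows "\<exists>y\<in>S. x - y \<in> orth_compl ip S"
proof -
  note sub = closed_subspaceD(1)[OF S]
  define D where "D = (\<lambda>y. nrm (x - y)) ` S"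
  define d where "d = Inf D"
  have ne: "D \<noteq> {}" using subspace_0[OF sub] by (auto simp: D_def)
  have bdd: "bdd_below D" by (rule bdd_belowI[of _ 0]) (auto simp: D_def)
  have d_le: "d \<le> nrm (x - y)" if "y \<in> S" for y
    unfolding d_def using that bdd by (intro cInf_lower) (auto simp: D_def)
  have d0: "0 \<le> d" unfolding d_def using ne by (intro cInf_greatest) (auto simp: D_def)
  have "\<exists>y\<in>S. nrm (x - y) < d + inverse (real (Suc n))" for n
    using cInf_lessD[OF ne, of "d + inverse (real (Suc n))"] by (auto simp: d_def D_def)
  then obtain f where fS: "\<And>n. f n \<in> S" and f: "\<And>n. nrm (x - f n) < d + inverse (real (Suc n))"
    by metis
  have lim: "(\<lambda>n. nrm (x - f n)) \<longlonglongrightarrow> d"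
  proof (rule tendsto_sandwich)
    show "\<forall>\<^sub>F n in sequentially. d \<le> nrm (x - f n)" using d_le fS by simp
    show "\<forall>\<^sub>F n in sequentially. nrm (x - f n) \<le> d + inverse (real (Suc n))"
      using f by (intro always_eventually allI less_imp_le)
    show "(\<lambda>n. d + inverse (real (Suc n))) \<longlonglongrightarrow> d"
      using tendsto_add[OF tendsto_const[of d] LIMSEQ_inverse_real_of_nat] by simp
  qed simp
  have "cauchy_seq f"
    unfolding cauchy_seq_def
  proof (intro allI impI)
    fix e :: real assume e: "e > 0"
    have "\<forall>\<^sub>F n in sequentially. (nrm (x - f n))\<^sup>2 < d\<^sup>2 + e\<^sup>2 / 4"
      using order_tendstoD(2)[OF tendsto_power[OF lim, of 2], of "d\<^sup>2 + e\<^sup>2 / 4"] e by simp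
    then obtain M where M: "\<And>n. n \<ge> M \<Longrightarrow> (nrm (x - f n))\<^sup>2 < d\<^sup>2 + e\<^sup>2 / 4"
      unfolding eventually_sequentially by blast
    have "nrm (f m - f n) < e" if mn: "m \<ge> M" "n \<ge> M" for m n
    proof (rule power2_less_imp_less)
      \<comment> \<open>the midpoint of two near-minimisers lies in the subspace, so it is at distance at least \<open>d\<close> from \<open>x\<close>\<close>
      define z where "z = smul (1 / 2) (f m + f n)"
      have zS: "z \<in> S" unfolding z_def by (intro subspace_scale[OF sub] subspace_add[OF sub] fS)
      have "(x - f m) + (x - f n) = smul 2 (x - z)"
        using scale_left_distrib[of 1 1 x]
        by (simp add: z_def scale_right_diff_distrib algebra_simps)
      then have "(nrm ((x - f m) + (x - f n)))\<^sup>2 = 4 * (nrm (x - z))\<^sup>2"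
        by (simp add: nrm_scale power_mult_distrib)
      moreover have "d\<^sup>2 \<le> (nrm (x - z))\<^sup>2" using d_le[OF zS] d0 by (rule power_mono)
      moreover have "(x - f m) - (x - f n) = f n - f m" by simp
      ultimately have "4 * d\<^sup>2 + (nrm (f n - f m))\<^sup>2 \<le> 2 * (nrm (x - f m))\<^sup>2 + 2 * (nrm (x - f n))\<^sup>2"
        using parallelogram[of "x - f m" "x - f n"] by simp
      then show "(nrm (f m - f n))\<^sup>2 < e\<^sup>2"
        using M[OF mn(1)] M[OF mn(2)] nrm_minus_commute[of "f m" "f n"] by simp
    qed (use e in simp)
    then show "\<exists>M. \<forall>m\<ge>M. \<forall>n\<ge>M. nrm (f m - f n) < e" by blast
  qed
  then obtain y where y: "(\<lambda>n. nrm (f n - y)) \<longlonglongrightarrow> 0" by (rule cauchy_seq_converges)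
  have yS: "y \<in> S" using closed_subspaceD(2)[OF S fS y] .
  have xy: "nrm (x - y) \<le> d"
  proof (rule LIMSEQ_le_const)
    show "(\<lambda>n. nrm (x - f n) + nrm (f n - y)) \<longlonglongrightarrow> d" using tendsto_add[OF lim y] by simp
    show "\<exists>N. \<forall>n\<ge>N. nrm (x - y) \<le> nrm (x - f n) + nrm (f n - y)" using nrm_triangle_diff by blast
  qed
  have "ip (x - y) z = 0" if z: "z \<in> S" for z
  proof (cases "z = 0")
    case False
    define c where "c = ip (x - y) z / ip z z"
    have "y + smul c z \<in> S" by (intro subspace_add[OF sub] subspace_scale[OF sub] yS z)
    then have "nrm (x - y) \<le> nrm ((x - y) - smul c z)"
      using d_le[of "y + smul c z"] xy by (simp add: algebra_simps)
    then have "(nrm (x - y))\<^sup>2 \<le> (nrm ((x - y) - smul c z))\<^sup>2" by (rule power_mono) simp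
    then have "(norm (ip (x - y) z) / nrm z)\<^sup>2 \<le> 0"
      unfolding c_def nrm_sq_minus_component[OF False] by simp
    then show ?thesis using False by simp
  qed simp
  then show ?thesis using yS unfolding orth_compl_def by blast
qed

lemma orth_proj_eqI:
  assumes S: "closed_subspace smul ip S" and y: "y \<in> S" "\<And>z. z \<in> S \<Longrightarrow> ip (x - y) z = 0"
  shows "orth_proj ip S x = y"
  unfolding orth_proj_def
proof (rule the_equality)
  show "y \<in> S \<and> x - y \<in> orth_compl ip S" using y by (simp add: orth_compl_def)
next
  fix y' assume y': "y' \<in> S \<and> x - y' \<in> orth_compl ip S"
  have dS: "y' - y \<in> S" using y y' closed_subspaceD(1)[OF S] subspace_diff by blast
  have "y' - y = (x - y) - (x - y')" by simp
  then have "ip (y' - y) (y' - y) = ip (x - y) (y' - y) - ip (x - y') (y' - y)"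
    by (metis ip_diff_left)
  also have "\<dots> = 0" using y(2)[OF dS] y' dS by (simp add: orth_compl_def)
  finally show "y' = y" by (simp add: ip_self)
qed

lemma
  assumes S: "closed_subspace smul ip S"
  shows orth_proj_mem: "orth_proj ip S x \<in> S"
    and orth_proj_residual: "z \<in> S \<Longrightarrow> ip (x - orth_proj ip S x) z = 0"
proof -
  obtain y where y: "y \<in> S" "x - y \<in> orth_compl ip S"
    using orthogonal_decomposition_exists[OF S] by blast
  then have "orth_proj ip S x = y" by (intro orth_proj_eqI[OF S]) (auto simp: orth_compl_def)
  then show "orth_proj ip S x \<in> S" "z \<in> S \<Longrightarrow> ip (x - orth_proj ip S x) z = 0"
    using y by (auto simp: orth_compl_def)
qed

lemma ip_orth_proj_left:
  assumes "closed_subspace smul ip S" "z \<in> S"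
  shows "ip (orth_proj ip S x) z = ip x z"
  using orth_proj_residual[OF assms, of x] by (simp add: ip_diff_left)

lemma ip_orth_proj_right:
  assumes "closed_subspace smul ip S" "z \<in> S"
  shows "ip z (orth_proj ip S x) = ip z x"
  using ip_orth_proj_left[OF assms, of x] by (metis ip_cnj)

lemma orth_proj_fixed: "closed_subspace smul ip S \<Longrightarrow> x \<in> S \<Longrightarrow> orth_proj ip S x = x"
  by (rule orth_proj_eqI) simp_all

lemma orth_proj_eq_0:
  assumes S: "closed_subspace smul ip S" and x: "x \<in> orth_compl ip S"
  shows "orth_proj ip S x = 0"
  using x subspace_0[OF closed_subspaceD(1)[OF S]]
  by (intro orth_proj_eqI[OF S]) (auto simp: orth_compl_def)

lemma orth_proj_add:
  assumes S: "closed_subspace smul ip S"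
  shows "orth_proj ip S (x + y) = orth_proj ip S x + orth_proj ip S y"
proof (rule orth_proj_eqI[OF S])
  show "orth_proj ip S x + orth_proj ip S y \<in> S"
    by (intro subspace_add[OF closed_subspaceD(1)[OF S]] orth_proj_mem[OF S])
  show "ip (x + y - (orth_proj ip S x + orth_proj ip S y)) z = 0" if "z \<in> S" for z
    by (simp add: ip_add_left ip_diff_left ip_orth_proj_left[OF S that])
qed

lemma orth_proj_scale:
  assumes S: "closed_subspace smul ip S"
  shows "orth_proj ip S (smul c x) = smul c (orth_proj ip S x)"
proof (rule orth_proj_eqI[OF S])
  show "smul c (orth_proj ip S x) \<in> S"
    by (intro subspace_scale[OF closed_subspaceD(1)[OF S]] orth_proj_mem[OF S])
  show "ip (smul c x - smul c (orth_proj ip S x)) z = 0" if "z \<in> S" for z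
    by (simp add: ip_scale_left ip_diff_left ip_orth_proj_left[OF S that])
qed

lemma orth_proj_zero: "closed_subspace smul ip S \<Longrightarrow> orth_proj ip S 0 = 0"
  using orth_proj_scale[of S 0 0] by simp

lemma orth_proj_sum:
  assumes S: "closed_subspace smul ip S"
  shows "orth_proj ip S (sum f A) = (\<Sum>a\<in>A. orth_proj ip S (f a))"
  by (induction A rule: infinite_finite_induct) (simp_all add: orth_proj_zero[OF S] orth_proj_add[OF S])

lemma nrm_orth_proj_le:
  assumes S: "closed_subspace smul ip S"
  shows "nrm (orth_proj ip S x) \<le> nrm x"
proof (rule power2_le_imp_le)
  have "ip (x - orth_proj ip S x) (orth_proj ip S x) = 0"
    by (rule orth_proj_residual[OF S orth_proj_mem[OF S]])
  from nrm_sq_add_orthogonal[OF this]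
  show "(nrm (orth_proj ip S x))\<^sup>2 \<le> (nrm x)\<^sup>2" by simp
qed simp

section \<open>Uniform boundedness\<close>

text \<open>By Baire's theorem, one of the closed sets of vectors on which \<open>F\<close> is bounded by \<open>n\<close> contains a
  ball, and moving from its centre in the direction of \<open>y\<close> tests \<open>y\<close> against itself.\<close>

lemma weakly_bounded_imp_bounded:
  assumes weak: "\<And>h. \<exists>K. \<forall>y\<in>F. norm (ip y h) \<le> K"
  shows "\<exists>C. \<forall>y\<in>F. nrm y \<le> C"
proof -
  interpret M: Metric_space UNIV "ip_dist ip" by (rule Metric_space_ip_dist)
  define C where "C n = {h. \<forall>y\<in>F. norm (ip y h) \<le> real n}" for n
  have closed: "closedin (ip_topology ip) (C n)" for n
    unfolding closedin_iff_nrm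
  proof (intro allI impI, elim conjE)
    fix f l assume f: "\<forall>m. f m \<in> C n" and lim: "(\<lambda>m. nrm (f m - l)) \<longlonglongrightarrow> 0"
    have "norm (ip y l) \<le> real n" if y: "y \<in> F" for y
    proof (rule LIMSEQ_le_const)
      show "(\<lambda>m. real n + nrm y * nrm (f m - l)) \<longlonglongrightarrow> real n"
        using tendsto_add[OF tendsto_const tendsto_mult[OF tendsto_const lim], of "real n" "nrm y"] by simp
      have "norm (ip y l) \<le> real n + nrm y * nrm (f m - l)" for m
      proof -
        have "ip y l = ip y (f m) - ip y (f m - l)" by (simp add: ip_diff_right)
        then have "norm (ip y l) \<le> norm (ip y (f m)) + norm (ip y (f m - l))"
          by (metis norm_triangle_ineq4)
        also have "\<dots> \<le> real n + nrm y * nrm (f m - l)"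
          using f y by (intro add_mono Cauchy_Schwarz) (auto simp: C_def)
        finally show ?thesis .
      qed
      then show "\<exists>N. \<forall>m\<ge>N. norm (ip y l) \<le> real n + nrm y * nrm (f m - l)" by blast
    qed
    then show "l \<in> C n" by (simp add: C_def)
  qed
  have cover: "\<Union>(range C) = UNIV"
  proof -
    have "\<exists>n. h \<in> C n" for h
    proof -
      obtain K where "\<forall>y\<in>F. norm (ip y h) \<le> K" using weak by blast
      moreover obtain n :: nat where "K \<le> real n" using real_arch_simple by blast
      ultimately show ?thesis unfolding C_def by (blast intro: order_trans)
    qed
    then show ?thesis by auto
  qed
  have "\<exists>n. (ip_topology ip) interior_of (C n) \<noteq> {}"
  proof (rule ccontr)
    assume "\<not> ?thesis"
    then have "(ip_topology ip) interior_of \<Union>(range C) = {}"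
      using closed by (intro M.metric_Baire_category_alt[OF complete]) auto
    then show False
      unfolding cover using interior_of_topspace[of "ip_topology ip"] by simp
  qed
  then obtain n a where "a \<in> (ip_topology ip) interior_of (C n)" by blast
  then obtain T where T: "openin (ip_topology ip) T" "a \<in> T" "T \<subseteq> C n"
    unfolding interior_of_def by blast
  then obtain r where r: "r > 0" "M.mball a r \<subseteq> C n"
    unfolding M.openin_mtopology by blast
  have "nrm y \<le> 4 * real n / r" if y: "y \<in> F" for y
  proof (cases "y = 0")
    case False
    then have pos: "nrm y > 0" by (rule nrm_pos)
    \<comment> \<open>the multiple \<open>t y\<close> has norm \<open>r / 2\<close>, so it does not leave the ball of radius \<open>r\<close>\<close>
    define t where "t = r / (2 * nrm y)"
    have t: "t > 0" using r pos by (simp add: t_def)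
    have "a \<in> C n" "a + smul (of_real t) y \<in> C n"
      using r pos t nrm_minus[of "smul (of_real t) y"]
      by (auto intro!: subsetD[OF r(2)] simp: ip_dist_def nrm_scale) (simp add: t_def)
    then have "norm (ip y (a + smul (of_real t) y) - ip y a) \<le> real n + real n"
      using y norm_triangle_ineq4[of "ip y (a + smul (of_real t) y)" "ip y a"]
      by (fastforce simp: C_def)
    also have "ip y (a + smul (of_real t) y) - ip y a = of_real t * ip y y"
      by (simp add: ip_add_right ip_scale_right scalar_cnj_of_real)
    finally have "t * (nrm y)\<^sup>2 \<le> 2 * real n" using t by (simp add: norm_mult norm_ip_self)
    moreover have "t * (nrm y)\<^sup>2 = r * nrm y / 2" using pos by (simp add: t_def power2_eq_square)
    ultimately show ?thesis using r by (simp add: field_simps)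
  qed (use r in simp)
  then show ?thesis by blast
qed

text \<open>The homogeneous form of the uniform boundedness principle, obtained by rescaling each \<open>y i\<close> by
  \<open>r i\<close>. When \<open>r i = 0\<close>, the hypothesis forces \<open>y i\<close> to be orthogonal to everything.\<close>

lemma uniform_boundedness_family:
  fixes y :: "'i \<Rightarrow> 'a" and r :: "'i \<Rightarrow> real"
  assumes r: "\<And>i. i \<in> I \<Longrightarrow> 0 \<le> r i"
    and bound: "\<And>h. \<exists>K. \<forall>i\<in>I. norm (ip (y i) h) \<le> K * r i"
  shows "\<exists>C>0. \<forall>i\<in>I. nrm (y i) \<le> C * r i"
proof -
  define F where "F = (\<lambda>i. smul (of_real (1 / r i)) (y i)) ` {i \<in> I. r i > 0}"
  have "\<exists>K. \<forall>z\<in>F. norm (ip z h) \<le> K" for h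
  proof -
    obtain K where K: "\<And>i. i \<in> I \<Longrightarrow> norm (ip (y i) h) \<le> K * r i" using bound by blast
    have "norm (ip z h) \<le> K" if "z \<in> F" for z
      using that K by (auto simp: F_def ip_scale_left norm_mult norm_divide field_simps)
    then show ?thesis by blast
  qed
  from weakly_bounded_imp_bounded[OF this]
  obtain C where C: "\<And>z. z \<in> F \<Longrightarrow> nrm z \<le> C" by blast
  have "nrm (y i) \<le> max C 1 * r i" if i: "i \<in> I" for i
  proof (cases "r i = 0")
    case True
    obtain K where "norm (ip (y i) (y i)) \<le> K * r i" using bound i by blast
    then show ?thesis using True by (simp add: norm_ip_self)
  next
    case False
    then have p: "r i > 0" using r[OF i] by simp
    then have "nrm (smul (of_real (1 / r i)) (y i)) \<le> C" using i by (intro C) (auto simp: F_def)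
    then have "nrm (y i) \<le> C * r i" using p by (simp add: nrm_scale norm_divide field_simps)
    also have "\<dots> \<le> max C 1 * r i" using p by (intro mult_right_mono) simp_all
    finally show ?thesis .
  qed
  then show ?thesis by (intro exI[of _ "max C 1"]) simp
qed

section \<open>Closed and dense ranges\<close>

text \<open>The hypothesis on orthogonal vectors says that \<open>R\<close> is dense in \<open>W\<close>; for a closed \<open>R\<close>, the difference
  of a vector of \<open>W\<close> and its projection to \<open>R\<close> is orthogonal to \<open>R\<close>, hence zero.\<close>

lemma closed_subspace_eqI:
  assumes R: "closed_subspace smul ip R" and W: "subspace W" and RW: "R \<subseteq> W"
    and dense: "\<And>y. y \<in> W \<Longrightarrow> (\<And>z. z \<in> R \<Longrightarrow> ip y z = 0) \<Longrightarrow> y = 0"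
  shows "R = W"
proof
  show "W \<subseteq> R"
  proof
    fix w assume w: "w \<in> W"
    have "w - orth_proj ip R w \<in> W"
      using w orth_proj_mem[OF R] RW subspace_diff[OF W] by blast
    then have "w - orth_proj ip R w = 0" by (rule dense) (rule orth_proj_residual[OF R])
    then show "w \<in> R" using orth_proj_mem[OF R, of w] by simp
  qed
qed (rule RW)

end

text \<open>A lower bound makes preimages of a Cauchy sequence Cauchy, so completeness of the closed
  subspace \<open>V\<close> passes to its image.\<close>

lemma closed_subspace_image:
  fixes V :: "'a::ab_group_add set" and f :: "'a \<Rightarrow> 'b::ab_group_add"
  assumes hs1: "hilbert_space s1 ip1" and ips2: "inner_product_space s2 ip2"
    and V: "closed_subspace s1 ip1 V"
    and add: "\<And>x y. x \<in> V \<Longrightarrow> y \<in> V \<Longrightarrow> f (x + y) = f x + f y"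
    and hom: "\<And>c x. x \<in> V \<Longrightarrow> f (s1 c x) = s2 c (f x)"
    and above: "\<And>x. x \<in> V \<Longrightarrow> ip_norm ip2 (f x) \<le> C * ip_norm ip1 x"
    and below: "\<And>x. x \<in> V \<Longrightarrow> c * ip_norm ip1 x \<le> ip_norm ip2 (f x)" and c: "c > 0"
  shows "closed_subspace s2 ip2 (f ` V)"
proof -
  interpret X: hilbert_space s1 ip1 by fact
  interpret Y: inner_product_space s2 ip2 by fact
  note sub = X.closed_subspaceD(1)[OF V]
  have f0: "f 0 = 0" using hom[of 0 0] X.subspace_0[OF sub] by simp
  have fdiff: "f (x - y) = f x - f y" if "x \<in> V" "y \<in> V" for x y
    using add[of "x - y" y] X.subspace_diff[OF sub that] that by (simp add: algebra_simps)
  show ?thesis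
    unfolding closed_subspace_def Y.closedin_iff_nrm
  proof (intro conjI allI impI)
    show "Y.subspace (f ` V)"
    proof (rule Y.subspaceI)
      show "0 \<in> f ` V" using f0 X.subspace_0[OF sub] by force
      show "x + y \<in> f ` V" if "x \<in> f ` V" "y \<in> f ` V" for x y
        using that X.subspace_add[OF sub] by (auto simp: add[symmetric])
      show "s2 a x \<in> f ` V" if "x \<in> f ` V" for a x
        using that X.subspace_scale[OF sub] by (auto simp: hom[symmetric])
    qed
  next
    fix g l assume "(\<forall>n. g n \<in> f ` V) \<and> (\<lambda>n. Y.nrm (g n - l)) \<longlonglongrightarrow> 0"
    then have gl: "(\<lambda>n. Y.nrm (g n - l)) \<longlonglongrightarrow> 0" and "\<forall>n. \<exists>x\<in>V. g n = f x" by blast+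
    then obtain x where xV: "\<And>n. x n \<in> V" and gx: "\<And>n. g n = f (x n)" by metis
    have "X.cauchy_seq x"
      unfolding X.cauchy_seq_def
    proof (intro allI impI)
      fix e :: real assume "e > 0"
      then obtain M where M: "\<And>m n. m \<ge> M \<Longrightarrow> n \<ge> M \<Longrightarrow> Y.nrm (g m - g n) < c * e"
        using Y.cauchy_seq_of_convergent[OF gl] c unfolding Y.cauchy_seq_def by (metis mult_pos_pos)
      have "X.nrm (x m - x n) < e" if "m \<ge> M" "n \<ge> M" for m n
      proof -
        have "c * X.nrm (x m - x n) < c * e"
          using below[OF X.subspace_diff[OF sub xV xV], of m n] M[OF that] by (simp add: gx fdiff xV)
        then show ?thesis using c by simp
      qed
      then show "\<exists>M. \<forall>m\<ge>M. \<forall>n\<ge>M. X.nrm (x m - x n) < e" by blast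
    qed
    then obtain k where k: "(\<lambda>n. X.nrm (x n - k)) \<longlonglongrightarrow> 0" by (rule X.cauchy_seq_converges)
    have kV: "k \<in> V" using X.closed_subspaceD(2)[OF V xV k] .
    have "(\<lambda>n. Y.nrm (g n - f k)) \<longlonglongrightarrow> 0"
    proof (rule tendsto_sandwich)
      show "\<forall>\<^sub>F n in sequentially. 0 \<le> Y.nrm (g n - f k)" by simp
      show "(\<lambda>n. C * X.nrm (x n - k)) \<longlonglongrightarrow> 0" using tendsto_mult[OF tendsto_const k, of C] by simp
      show "\<forall>\<^sub>F n in sequentially. Y.nrm (g n - f k) \<le> C * X.nrm (x n - k)"
        using above[OF X.subspace_diff[OF sub xV kV]] by (simp add: gx fdiff xV kV)
    qed simp_all
    from Y.limit_unique[OF gl this] kV show "l \<in> f ` V" by blast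
  qed
qed

section \<open>Orthogonal complements and sums of subspaces\<close>

context inner_product_space
begin

lemma subspace_orth_compl: "subspace (orth_compl ip M)"
  by (rule subspaceI) (auto simp: orth_compl_def ip_add_left ip_scale_left)

lemma subspace_sum_sets:
  assumes "finite I" "\<And>i. i \<in> I \<Longrightarrow> subspace (S i)"
  shows "subspace (\<Sum>i\<in>I. S i)"
  unfolding set_sum_alt[OF assms(1)]
proof (rule subspaceI)
  show "0 \<in> {sum s I |s. \<forall>i\<in>I. s i \<in> S i}"
    using subspace_0[OF assms(2)] by (auto intro!: exI[of _ "\<lambda>i. 0"])
next
  fix x y assume "x \<in> {sum s I |s. \<forall>i\<in>I. s i \<in> S i}" "y \<in> {sum s I |s. \<forall>i\<in>I. s i \<in> S i}"
  then obtain s t where "x = sum s I" "y = sum t I" "\<forall>i\<in>I. s i \<in> S i" "\<forall>i\<in>I. t i \<in> S i" by blast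
  then show "x + y \<in> {sum s I |s. \<forall>i\<in>I. s i \<in> S i}"
    using subspace_add[OF assms(2)]
    by (auto simp: sum.distrib[symmetric] intro!: exI[of _ "\<lambda>i. s i + t i"])
next
  fix c x assume "x \<in> {sum s I |s. \<forall>i\<in>I. s i \<in> S i}"
  then obtain s where "x = sum s I" "\<forall>i\<in>I. s i \<in> S i" by blast
  then show "smul c x \<in> {sum s I |s. \<forall>i\<in>I. s i \<in> S i}"
    using subspace_scale[OF assms(2)]
    by (auto simp: scale_sum_right intro!: exI[of _ "\<lambda>i. smul c (s i)"])
qed

end

section \<open>The orthogonal direct sum\<close>

lemma inner_product_space_dsum:
  assumes "inner_product_space smul ip"
  shows "inner_product_space (dsum_scale smul) (dsum_ip ip :: 'a::ab_group_add ^ 'n::finite \<Rightarrow> _)"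
    and dsum_norm_sq: "(ip_norm (dsum_ip ip) (x :: 'a ^ 'n))\<^sup>2 = (\<Sum>i\<in>UNIV. (ip_norm ip (x $ i))\<^sup>2)"
proof -
  interpret inner_product_space smul ip by fact
  have self: "dsum_ip ip x x = of_real (\<Sum>i\<in>UNIV. (nrm (x $ i))\<^sup>2)" for x :: "'a ^ 'n"
    by (simp add: dsum_ip_def ip_self)
  show "inner_product_space (dsum_scale smul) (dsum_ip ip :: 'a ^ 'n \<Rightarrow> _)"
  proof
    fix x y z :: "'a ^ 'n" and c d
    show "dsum_scale smul c (x + y) = dsum_scale smul c x + dsum_scale smul c y"
      "dsum_scale smul (c + d) x = dsum_scale smul c x + dsum_scale smul d x"
      "dsum_scale smul c (dsum_scale smul d x) = dsum_scale smul (c * d) x"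
      "dsum_scale smul 1 x = x"
      by (simp_all add: dsum_scale_def vec_eq_iff scale_right_distrib scale_left_distrib)
    show "dsum_ip ip (x + y) z = dsum_ip ip x z + dsum_ip ip y z"
      by (simp add: dsum_ip_def ip_add_left sum.distrib)
    show "dsum_ip ip (dsum_scale smul c x) y = c * dsum_ip ip x y"
      by (simp add: dsum_ip_def dsum_scale_def ip_scale_left sum_distrib_left)
    show "dsum_ip ip y x = scalar_cnj (dsum_ip ip x y)"
      unfolding dsum_ip_def scalar_cnj_sum by (rule sum.cong[OF refl ip_cnj])
    show "\<exists>r>0. dsum_ip ip x x = of_real r" if nz: "x \<noteq> 0"
    proof -
      obtain i where "x $ i \<noteq> 0" using nz by (metis vec_eq_iff zero_index)
      then have "0 < (\<Sum>i\<in>UNIV. (nrm (x $ i))\<^sup>2)" by (intro sum_pos2[of _ i]) auto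
      then show ?thesis using self by blast
    qed
  qed
  show "(ip_norm (dsum_ip ip) x)\<^sup>2 = (\<Sum>i\<in>UNIV. (nrm (x $ i))\<^sup>2)"
    by (simp add: ip_norm_def[of "dsum_ip ip"] self sum_nonneg del: of_real_sum)
qed

context inner_product_space
begin

lemma dsum_norm_eq: "ip_norm (dsum_ip ip) (x :: 'a ^ 'n::finite) = sqrt (\<Sum>i\<in>UNIV. (nrm (x $ i))\<^sup>2)"
  by (rule real_sqrt_unique[symmetric, OF dsum_norm_sq[OF inner_product_space_axioms]
        inner_product_space.nrm_nonneg[OF inner_product_space_dsum(1)[OF inner_product_space_axioms]]])

lemma nrm_component_le: "nrm (x $ i) \<le> ip_norm (dsum_ip ip) (x :: 'a ^ 'n::finite)"
  unfolding dsum_norm_eq using member_le_L2_set[of UNIV i "\<lambda>i. nrm (x $ i)"] by (simp add: L2_set_def)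

lemma dsum_norm_le_sum: "ip_norm (dsum_ip ip) (x :: 'a ^ 'n::finite) \<le> (\<Sum>i\<in>UNIV. nrm (x $ i))"
  unfolding dsum_norm_eq using L2_set_le_sum[of UNIV "\<lambda>i. nrm (x $ i)"] by (simp add: L2_set_def)

lemma sum_nrm_le_dsum_norm:
  "(\<Sum>i\<in>UNIV. nrm (x $ i)) \<le> real CARD('n) * ip_norm (dsum_ip ip) (x :: 'a ^ 'n::finite)"
  using sum_bounded_above[of UNIV "\<lambda>i. nrm (x $ i)" "ip_norm (dsum_ip ip) x", OF nrm_component_le]
  by simp

end

text \<open>The norm of a tuple lies between the norm of any entry and the sum of the norms of all entries, so
  completeness holds because it holds in every coordinate.\<close>

lemma hilbert_space_dsum:
  assumes "hilbert_space smul ip"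
  shows "hilbert_space (dsum_scale smul) (dsum_ip ip :: 'a::ab_group_add ^ 'n::finite \<Rightarrow> _)"
proof (rule hilbert_spaceI)
  interpret hilbert_space smul ip by fact
  show ips: "inner_product_space (dsum_scale smul) (dsum_ip ip :: 'a ^ 'n \<Rightarrow> _)"
    by (rule inner_product_space_dsum) unfold_locales
  interpret D: inner_product_space "dsum_scale smul" "dsum_ip ip :: 'a ^ 'n \<Rightarrow> _" by (rule ips)
  fix f :: "nat \<Rightarrow> 'a ^ 'n" assume f: "D.cauchy_seq f"
  have le: "nrm (f m $ i - f n $ i) \<le> D.nrm (f m - f n)" for m n i
    using nrm_component_le[of "f m - f n" i] by simp
  have "cauchy_seq (\<lambda>n. f n $ i)" for i
    unfolding cauchy_seq_def
  proof (intro allI impI)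
    fix e :: real assume "e > 0"
    then obtain M where "\<forall>m\<ge>M. \<forall>n\<ge>M. D.nrm (f m - f n) < e"
      using f unfolding D.cauchy_seq_def by blast
    then have "\<forall>m\<ge>M. \<forall>n\<ge>M. nrm (f m $ i - f n $ i) < e"
      by (intro allI impI le_less_trans[OF le]) simp
    then show "\<exists>M. \<forall>m\<ge>M. \<forall>n\<ge>M. nrm (f m $ i - f n $ i) < e" ..
  qed
  then have "\<forall>i. \<exists>l. (\<lambda>n. nrm (f n $ i - l)) \<longlonglongrightarrow> 0" by (metis cauchy_seq_converges)
  then obtain l where l: "\<And>i. (\<lambda>n. nrm (f n $ i - l i)) \<longlonglongrightarrow> 0" by metis
  have "(\<lambda>n. D.nrm (f n - (\<chi> i. l i))) \<longlonglongrightarrow> 0"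
  proof (rule tendsto_sandwich)
    show "\<forall>\<^sub>F n in sequentially. 0 \<le> D.nrm (f n - (\<chi> i. l i))" by simp
    show "\<forall>\<^sub>F n in sequentially. D.nrm (f n - (\<chi> i. l i)) \<le> (\<Sum>i\<in>UNIV. nrm (f n $ i - l i))"
      using dsum_norm_le_sum[of "f _ - (\<chi> i. l i)"] by simp
    show "(\<lambda>n. \<Sum>i\<in>UNIV. nrm (f n $ i - l i)) \<longlonglongrightarrow> 0" using tendsto_sum[of UNIV, OF l] by simp
  qed simp
  then show "\<exists>l. (\<lambda>n. D.nrm (f n - l)) \<longlonglongrightarrow> 0" by blast
qed

lemma closed_subspace_direct_sum:
  fixes H :: "'n::finite \<Rightarrow> 'a::ab_group_add set"
  assumes "inner_product_space smul ip" and H: "\<And>i. closed_subspace smul ip (H i)"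
  shows "closed_subspace (dsum_scale smul) (dsum_ip ip) (direct_sum H)"
proof -
  interpret inner_product_space smul ip by fact
  interpret D: inner_product_space "dsum_scale smul" "dsum_ip ip :: 'a ^ 'n \<Rightarrow> _"
    by (rule inner_product_space_dsum) fact
  note sub = closed_subspaceD(1)[OF H]
  show ?thesis
    unfolding closed_subspace_def D.closedin_iff_nrm
  proof (intro conjI allI impI)
    show "D.subspace (direct_sum H)"
      by (rule D.subspaceI)
        (auto simp: direct_sum_def dsum_scale_def intro: subspace_0 subspace_add subspace_scale sub)
  next
    fix f l assume fl: "(\<forall>n. f n \<in> direct_sum H) \<and> (\<lambda>n. D.nrm (f n - l)) \<longlonglongrightarrow> 0"
    have "l $ i \<in> H i" for i
    proof (rule closed_subspaceD(2)[OF H])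
      show "f n $ i \<in> H i" for n using fl by (auto simp: direct_sum_def)
      show "(\<lambda>n. nrm (f n $ i - l $ i)) \<longlonglongrightarrow> 0"
      proof (rule tendsto_sandwich)
        show "\<forall>\<^sub>F n in sequentially. 0 \<le> nrm (f n $ i - l $ i)" by simp
        show "\<forall>\<^sub>F n in sequentially. nrm (f n $ i - l $ i) \<le> D.nrm (f n - l)"
          using nrm_component_le[of "f _ - l" i] by simp
      qed (use fl in simp_all)
    qed
    then show "l \<in> direct_sum H" by (simp add: direct_sum_def)
  qed
qed

section \<open>Isomorphisms and norm bounds\<close>

lemma hilbert_isomorphismI:
  fixes V :: "'a::ab_group_add set" and f :: "'a \<Rightarrow> 'b::ab_group_add"
  assumes ips1: "inner_product_space s1 ip1" and ips2: "inner_product_space s2 ip2"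
    and V: "module.subspace s1 V" and W: "module.subspace s2 W" and fV: "f ` V = W"
    and add: "\<And>x y. x \<in> V \<Longrightarrow> y \<in> V \<Longrightarrow> f (x + y) = f x + f y"
    and hom: "\<And>c x. x \<in> V \<Longrightarrow> f (s1 c x) = s2 c (f x)"
    and above: "\<And>x. x \<in> V \<Longrightarrow> ip_norm ip2 (f x) \<le> C * ip_norm ip1 x"
    and below: "\<And>x. x \<in> V \<Longrightarrow> c * ip_norm ip1 x \<le> ip_norm ip2 (f x)" and c: "c > 0"
  shows "hilbert_isomorphism s1 ip1 V s2 ip2 W f"
proof -
  interpret X: inner_product_space s1 ip1 by fact
  interpret Y: inner_product_space s2 ip2 by fact
  have inj: "inj_on f V"
  proof (rule inj_onI)
    fix x y assume xy: "x \<in> V" "y \<in> V" "f x = f y"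
    have d: "x - y \<in> V" using xy X.subspace_diff[OF V] by blast
    have "f x = f (x - y) + f y" using add[OF d xy(2)] by simp
    then have "c * ip_norm ip1 (x - y) \<le> 0" using xy(3) below[OF d] by simp
    then have "ip_norm ip1 (x - y) = 0"
      using c X.nrm_nonneg[of "x - y"] by (simp add: mult_le_0_iff)
    then show "x = y" by simp
  qed
  let ?g = "inv_into V f"
  have g: "?g y \<in> V" "f (?g y) = y" if "y \<in> W" for y
    using that fV by (auto intro: inv_into_into f_inv_into_f)
  have gf: "?g y = x" if "x \<in> V" "f x = y" for x y
    using that inj by (auto simp: inv_into_f_f)
  have cont_f: "continuous_map (subtopology (ip_topology ip1) V) (subtopology (ip_topology ip2) W) f"
  proof (rule iffD2)
    show "continuous_map (subtopology (ip_topology ip1) V) (subtopology (ip_topology ip2) W) f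
        \<longleftrightarrow> (\<exists>C. \<forall>x\<in>V. ip_norm ip2 (f x) \<le> C * ip_norm ip1 x)"
      by (rule continuous_linear_iff_bounded[OF ips1 ips2 V]) (simp_all add: add hom fV)
    show "\<exists>C. \<forall>x\<in>V. ip_norm ip2 (f x) \<le> C * ip_norm ip1 x" using above by blast
  qed
  have cont_g: "continuous_map (subtopology (ip_topology ip2) W) (subtopology (ip_topology ip1) V) ?g"
  proof (subst continuous_linear_iff_bounded[OF ips2 ips1 W])
    show "?g (x + y) = ?g x + ?g y" if "x \<in> W" "y \<in> W" for x y
      using g[OF that(1)] g[OF that(2)] by (intro gf X.subspace_add[OF V]) (simp_all add: add)
    show "?g (s2 a x) = s1 a (?g x)" if "x \<in> W" for a x
      using g[OF that] by (intro gf X.subspace_scale[OF V]) (simp_all add: hom)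
    show "?g ` W \<subseteq> V" using g by blast
    have "ip_norm ip1 (?g y) \<le> 1 / c * ip_norm ip2 y" if "y \<in> W" for y
      using below[OF g(1)[OF that]] g(2)[OF that] c by (simp add: field_simps)
    then show "\<exists>C. \<forall>x\<in>W. ip_norm ip1 (?g x) \<le> C * ip_norm ip2 x" by blast
  qed
  show ?thesis
    unfolding hilbert_isomorphism_def bij_betw_def
    using add hom inj fV cont_f cont_g by blast
qed

lemma hilbert_isomorphism_UNIV_bounds:
  fixes f :: "'a::ab_group_add \<Rightarrow> 'b::ab_group_add"
  assumes ips1: "inner_product_space s1 ip1" and ips2: "inner_product_space s2 ip2"
    and iso: "hilbert_isomorphism s1 ip1 UNIV s2 ip2 UNIV f"
  obtains C where "\<And>x. ip_norm ip2 (f x) \<le> C * ip_norm ip1 x"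
    and "\<And>x. ip_norm ip1 x \<le> C * ip_norm ip2 (f x)"
proof -
  interpret X: inner_product_space s1 ip1 by fact
  interpret Y: inner_product_space s2 ip2 by fact
  have add: "f (x + y) = f x + f y" and hom: "f (s1 c x) = s2 c (f x)" for x y c
    using iso by (auto simp: hilbert_isomorphism_def)
  have bij: "bij f" using iso by (simp add: hilbert_isomorphism_def)
  have fi: "f (inv f y) = y" and inf: "inv f (f x) = x" for x y
    using bij by (auto simp: bij_is_surj surj_f_inv_f bij_is_inj)
  have "continuous_map (subtopology (ip_topology ip1) UNIV) (subtopology (ip_topology ip2) UNIV) f"
    using iso by (simp add: hilbert_isomorphism_def)
  then obtain C1 where C1: "\<And>x. ip_norm ip2 (f x) \<le> C1 * ip_norm ip1 x"
    by (subst (asm) continuous_linear_iff_bounded[OF ips1 ips2]) (auto simp: add hom)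
  have "continuous_map (subtopology (ip_topology ip2) UNIV) (subtopology (ip_topology ip1) UNIV) (inv f)"
    using iso by (simp add: hilbert_isomorphism_def)
  moreover have "inv f (x + y) = inv f x + inv f y" for x y
    using inf[of "inv f x + inv f y"] by (simp add: add fi)
  moreover have "inv f (s2 c x) = s1 c (inv f x)" for x c
    using inf[of "s1 c (inv f x)"] by (simp add: hom fi)
  ultimately obtain C2 where C2: "\<And>y. ip_norm ip1 (inv f y) \<le> C2 * ip_norm ip2 y"
    by (subst (asm) continuous_linear_iff_bounded[OF ips2 ips1]) auto
  show ?thesis
  proof (rule that)
    show "ip_norm ip2 (f x) \<le> max C1 C2 * ip_norm ip1 x" for x
      using C1[of x] by (rule order_trans) (intro mult_right_mono, simp_all)
    show "ip_norm ip1 x \<le> max C1 C2 * ip_norm ip2 (f x)" for x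
      using C2[of "f x"] unfolding inf by (rule order_trans) (intro mult_right_mono, simp_all)
  qed
qed

section \<open>Quantitative independence\<close>

text \<open>The hub of the equivalence: the summation map from the orthogonal direct sum is bounded below. This
  is the positivity of the infimum of the quotients, written without division, so that the zero tuple
  needs no exception.\<close>

definition sum_bounded_below :: "('a::ab_group_add \<Rightarrow> 'a \<Rightarrow> 'k::real_or_complex) \<Rightarrow> ('n::finite \<Rightarrow> 'a set) \<Rightarrow> bool" where
  "sum_bounded_below ip H \<longleftrightarrow> (\<exists>c>0. \<forall>x. (\<forall>i. x i \<in> H i) \<longrightarrow>
      c * sqrt (\<Sum>i\<in>UNIV. (ip_norm ip (x i))\<^sup>2) \<le> ip_norm ip (\<Sum>i\<in>UNIV. x i))"

context inner_product_space
begin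

lemma Inf_quotient_pos_iff:
  fixes H :: "'n::finite \<Rightarrow> 'a set"
  shows "Inf {ereal (nrm (\<Sum>i\<in>UNIV. x i) / sqrt (\<Sum>i\<in>UNIV. (nrm (x i))\<^sup>2)) | x.
      (\<forall>i. x i \<in> H i) \<and> x \<noteq> (\<lambda>i. 0)} > 0 \<longleftrightarrow> sum_bounded_below ip H" (is "Inf ?Q > 0 \<longleftrightarrow> _")
proof -
  have pos: "sqrt (\<Sum>i\<in>UNIV. (nrm (x i))\<^sup>2) > 0" if nz: "x \<noteq> (\<lambda>i. 0)" for x :: "'n \<Rightarrow> 'a"
  proof -
    obtain i where "x i \<noteq> 0" using nz by blast
    then have "0 < (\<Sum>i\<in>UNIV. (nrm (x i))\<^sup>2)" by (intro sum_pos2[of _ i]) auto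
    then show ?thesis by simp
  qed
  show ?thesis
  proof
    assume "Inf ?Q > 0"
    then obtain c where c: "0 < ereal c" "ereal c < Inf ?Q" by (meson ereal_dense2)
    have "c * sqrt (\<Sum>i\<in>UNIV. (nrm (x i))\<^sup>2) \<le> nrm (\<Sum>i\<in>UNIV. x i)" if x: "\<forall>i. x i \<in> H i" for x
    proof (cases "x = (\<lambda>i. 0)")
      case False
      have "ereal (nrm (\<Sum>i\<in>UNIV. x i) / sqrt (\<Sum>i\<in>UNIV. (nrm (x i))\<^sup>2)) \<in> ?Q"
        using x False by blast
      then have "ereal c < ereal (nrm (\<Sum>i\<in>UNIV. x i) / sqrt (\<Sum>i\<in>UNIV. (nrm (x i))\<^sup>2))"
        using c(2) by (meson Inf_lower less_le_trans)
      then show ?thesis using pos[OF False] by (simp add: field_simps)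
    qed simp
    then show "sum_bounded_below ip H" unfolding sum_bounded_below_def using c by auto
  next
    assume "sum_bounded_below ip H"
    then obtain c where c: "c > 0" and *: "\<And>x. (\<forall>i. x i \<in> H i) \<Longrightarrow>
        c * sqrt (\<Sum>i\<in>UNIV. (nrm (x i))\<^sup>2) \<le> nrm (\<Sum>i\<in>UNIV. x i)"
      unfolding sum_bounded_below_def by blast
    have "ereal c \<le> Inf ?Q"
    proof (rule Inf_greatest)
      fix q assume "q \<in> ?Q"
      then obtain x where q: "q = ereal (nrm (\<Sum>i\<in>UNIV. x i) / sqrt (\<Sum>i\<in>UNIV. (nrm (x i))\<^sup>2))"
        and x: "\<forall>i. x i \<in> H i" "x \<noteq> (\<lambda>i. 0)" by blast
      show "ereal c \<le> q" unfolding q using *[OF x(1)] pos[OF x(2)] by (simp add: pos_le_divide_eq)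
    qed
    then show "Inf ?Q > 0" using c by (meson ereal_less(2) less_le_trans)
  qed
qed

text \<open>By homogeneity the unit sphere of \<open>Y\<close> may be replaced by all of \<open>Y\<close>, which also absorbs the value
  \<open>\<infinity>\<close> at \<open>Y = {0}\<close>.\<close>

lemma inclination_pos_iff:
  assumes Y: "subspace Y" and Z: "subspace Z"
  shows "inclination ip Y Z > 0 \<longleftrightarrow> (\<exists>c>0. \<forall>y\<in>Y. \<forall>z\<in>Z. c * nrm y \<le> nrm (y - z))"
proof (cases "Y = {0}")
  case True
  then show ?thesis by (auto simp: inclination_def intro: exI[of _ 1])
next
  case False
  let ?I = "Inf {dist_to_set ip y Z | y. y \<in> Y \<and> nrm y = 1}"
  have incl: "inclination ip Y Z = ?I" using False by (simp add: inclination_def)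
  show ?thesis
  proof
    assume "inclination ip Y Z > 0"
    then obtain c where c: "0 < ereal c" "ereal c < ?I" unfolding incl by (meson ereal_dense2)
    have unit: "c \<le> nrm (y - z)" if "y \<in> Y" "nrm y = 1" "z \<in> Z" for y z
    proof -
      have "?I \<le> dist_to_set ip y Z" using that by (intro Inf_lower) blast
      also have "\<dots> \<le> ereal (nrm (y - z))"
        unfolding dist_to_set_def using that by (intro Inf_lower) blast
      finally have "ereal c < ereal (nrm (y - z))" using c(2) by (rule less_le_trans[rotated])
      then show ?thesis by simp
    qed
    have "c * nrm y \<le> nrm (y - z)" if y: "y \<in> Y" and z: "z \<in> Z" for y z
    proof (cases "y = 0")
      case False
      then have p: "nrm y > 0" by (rule nrm_pos)
      define a where "a = (of_real (1 / nrm y) :: 'k)"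
      have "c \<le> nrm (smul a y - smul a z)"
        using False by (intro unit subspace_scale[OF Y y] subspace_scale[OF Z z])
          (simp add: nrm_scale a_def norm_divide)
      also have "\<dots> = nrm (y - z) / nrm y"
        by (simp add: scale_right_diff_distrib[symmetric] nrm_scale a_def norm_divide)
      finally show ?thesis using p by (simp add: field_simps)
    qed simp
    then show "\<exists>c>0. \<forall>y\<in>Y. \<forall>z\<in>Z. c * nrm y \<le> nrm (y - z)" using c(1) by auto
  next
    assume "\<exists>c>0. \<forall>y\<in>Y. \<forall>z\<in>Z. c * nrm y \<le> nrm (y - z)"
    then obtain c where c: "c > 0" and *: "\<And>y z. y \<in> Y \<Longrightarrow> z \<in> Z \<Longrightarrow> c * nrm y \<le> nrm (y - z)" by blast
    have "ereal c \<le> dist_to_set ip y Z" if "y \<in> Y" "nrm y = 1" for y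
      unfolding dist_to_set_def using *[OF that(1)] that(2) by (auto intro!: Inf_greatest)
    then have "ereal c \<le> ?I" by (auto intro!: Inf_greatest)
    then show "inclination ip Y Z > 0" unfolding incl using c by (meson ereal_less(2) less_le_trans)
  qed
qed

text \<open>It suffices to control each summand separately by the sum, as the Euclidean norm of a tuple of
  norms is at most their sum.\<close>

lemma sum_bounded_belowI:
  fixes H :: "'n::finite \<Rightarrow> 'a set"
  assumes "\<And>x i. (\<forall>i. x i \<in> H i) \<Longrightarrow> nrm (x i) \<le> K i * nrm (\<Sum>i\<in>UNIV. x i)"
  shows "sum_bounded_below ip H"
proof -
  \<comment> \<open>the constants \<open>K i\<close> may vanish or be negative; \<open>C\<close> has to be positive\<close>
  define C where "C = 1 + (\<Sum>i\<in>UNIV. \<bar>K i\<bar>)"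
  have C: "C > 0" unfolding C_def by (rule add_pos_nonneg) (simp_all add: sum_nonneg)
  have "1 / C * sqrt (\<Sum>i\<in>UNIV. (nrm (x i))\<^sup>2) \<le> nrm (\<Sum>i\<in>UNIV. x i)" if x: "\<forall>i. x i \<in> H i" for x
  proof -
    have "sqrt (\<Sum>i\<in>UNIV. (nrm (x i))\<^sup>2) \<le> (\<Sum>i\<in>UNIV. nrm (x i))"
      using L2_set_le_sum[of UNIV "\<lambda>i. nrm (x i)"] by (simp add: L2_set_def)
    also have "\<dots> \<le> (\<Sum>i\<in>UNIV. \<bar>K i\<bar> * nrm (\<Sum>i\<in>UNIV. x i))"
      by (intro sum_mono order_trans[OF assms[OF x]] mult_right_mono) simp_all
    also have "\<dots> \<le> C * nrm (\<Sum>i\<in>UNIV. x i)"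
      unfolding sum_distrib_right[symmetric] by (intro mult_right_mono) (simp_all add: C_def)
    finally show ?thesis using C by (simp add: field_simps)
  qed
  then show ?thesis unfolding sum_bounded_below_def using C by (metis zero_less_divide_1_iff)
qed

end

section \<open>Inverse best approximation and annihilators\<close>

locale subspace_system = hilbert_space smul ip
  for smul :: "'k::real_or_complex \<Rightarrow> 'a::ab_group_add \<Rightarrow> 'a" and ip +
  fixes H :: "'n::finite \<Rightarrow> 'a set"
  assumes closed: "\<And>i. closed_subspace smul ip (H i)"
begin

abbreviation P :: "'n \<Rightarrow> 'a \<Rightarrow> 'a" where "P k \<equiv> orth_proj ip (H k)"

lemma sub: "subspace (H i)"
  using closed_subspaceD(1)[OF closed] .

lemmas P_mem = orth_proj_mem[OF closed]
lemmas P_zero = orth_proj_zero[OF closed]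
lemmas P_add = orth_proj_add[OF closed]
lemmas P_scale = orth_proj_scale[OF closed]
lemmas P_sum = orth_proj_sum[OF closed]
lemmas P_fixed = orth_proj_fixed[OF closed]

lemma P_eq_0_iff: "P k x = 0 \<longleftrightarrow> x \<in> orth_compl ip (H k)"
proof
  assume "P k x = 0"
  then show "x \<in> orth_compl ip (H k)"
    using orth_proj_residual[OF closed, of _ k x] by (simp add: orth_compl_def)
qed (rule orth_proj_eq_0[OF closed])

lemma mem_sum_iff: "m \<in> (\<Sum>i\<in>I. H i) \<longleftrightarrow> (\<exists>x. (\<forall>i\<in>I. x i \<in> H i) \<and> m = sum x I)"
  by (auto simp: set_sum_alt)

lemma sub_Sum: "subspace (\<Sum>i\<in>I. H i)"
  by (rule subspace_sum_sets) (simp_all add: sub)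

abbreviation "others_compl i \<equiv> \<Inter>j\<in>UNIV - {i}. orth_compl ip (H j)"

text \<open>To split \<open>h\<close>, interpolate the data \<open>(0, \<dots>, P k h, \<dots>, 0)\<close> by some \<open>y k\<close> for every \<open>k\<close>. Then \<open>y k\<close>
  annihilates all \<open>H j\<close> with \<open>j \<noteq> k\<close>, and \<open>h\<close> minus the sum of the \<open>y k\<close> annihilates every \<open>H j\<close>.\<close>

lemma IBAP_imp_sum_others_compl:
  assumes "IBAP ip H"
  shows "(\<Sum>i\<in>UNIV. others_compl i) = UNIV"
proof -
  have "h \<in> (\<Sum>i\<in>UNIV. others_compl i)" for h
  proof -
    have "\<exists>y. \<forall>j. P j y = (if j = k then P k h else 0)" for k
      using assms P_mem subspace_0[OF sub] unfolding IBAP_def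
      by (elim allE[of _ "\<lambda>j. if j = k then P k h else 0"]) (auto split: if_splits)
    then obtain y where y: "\<And>k j. P j (y k) = (if j = k then P k h else 0)" by metis
    define w where "w = h - (\<Sum>k\<in>UNIV. y k)"
    have w: "P j w = 0" for j
    proof -
      have "P j h = P j (w + (\<Sum>k\<in>UNIV. y k))" by (simp add: w_def)
      also have "\<dots> = P j w + P j h" by (simp add: P_add P_sum y)
      finally show ?thesis by simp
    qed
    \<comment> \<open>the remainder \<open>w\<close> lies in all the summands; it is put into an arbitrary one\<close>
    fix i0 :: 'n
    define x where "x k = y k + (if k = i0 then w else 0)" for k
    have "x k \<in> others_compl k" for k
      by (auto simp: P_eq_0_iff[symmetric] x_def P_add y w P_zero)
    moreover have "h = (\<Sum>k\<in>UNIV. x k)"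
      by (simp add: x_def sum.distrib w_def)
    ultimately show ?thesis by (auto simp: set_sum_alt)
  qed
  then show ?thesis by blast
qed

lemma sum_others_compl_imp_complement:
  assumes "(\<Sum>i\<in>UNIV. others_compl i) = UNIV"
  shows "orth_compl ip (H i) + others_compl i = UNIV"
proof -
  have "h \<in> orth_compl ip (H i) + others_compl i" for h
  proof -
    have "h \<in> (\<Sum>i\<in>UNIV. others_compl i)" using assms by simp
    then obtain x where h: "h = (\<Sum>k\<in>UNIV. x k)" and x: "\<And>k. x k \<in> others_compl k"
      by (auto simp: set_sum_alt)
    have "(\<Sum>k\<in>UNIV - {i}. x k) \<in> orth_compl ip (H i)"
      using x by (intro subspace_sum[OF subspace_orth_compl]) fastforce
    moreover have "h = (\<Sum>k\<in>UNIV - {i}. x k) + x i" by (simp add: h sum.remove[of UNIV i] add.commute)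
    ultimately show ?thesis using x[of i] by (auto simp: set_plus_def)
  qed
  then show ?thesis by blast
qed

text \<open>Splitting \<open>x k\<close> as \<open>u + v\<close> gives a vector \<open>v\<close> that solves the interpolation problem for the data
  \<open>(0, \<dots>, x k, \<dots>, 0)\<close>; the sum of these solves it for arbitrary data.\<close>

lemma complement_imp_IBAP:
  assumes "\<And>i. orth_compl ip (H i) + others_compl i = UNIV"
  shows "IBAP ip H"
  unfolding IBAP_def
proof (intro allI impI)
  fix x assume x: "\<forall>k. x k \<in> H k"
  have "\<exists>v. \<forall>j. P j v = (if j = k then x k else 0)" for k
  proof -
    have "x k \<in> orth_compl ip (H k) + others_compl k" using assms by simp
    then obtain u v where uv: "x k = u + v" "u \<in> orth_compl ip (H k)" "v \<in> others_compl k"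
      by (rule set_plus_elim)
    have "P k (x k) = P k u + P k v" by (simp add: uv(1) P_add)
    then have "P k v = x k" using uv(2) x by (simp add: P_fixed P_eq_0_iff[THEN iffD2])
    moreover have "P j v = 0" if "j \<noteq> k" for j using uv(3) that by (auto simp: P_eq_0_iff)
    ultimately show ?thesis by (intro exI[of _ v]) simp
  qed
  then obtain v where v: "\<And>k j. P j (v k) = (if j = k then x k else 0)" by metis
  have "P k (\<Sum>j\<in>UNIV. v j) = x k" for k by (simp add: P_sum v)
  then show "\<exists>y. \<forall>k. P k y = x k" by blast
qed

text \<open>If \<open>h = u + v\<close> with \<open>u\<close> annihilating \<open>H i\<close> and \<open>v\<close> annihilating the other subspaces, then
  \<open>\<langle>y, h\<rangle> = \<langle>y - z, v\<rangle>\<close> for \<open>y\<close> in \<open>H i\<close> and \<open>z\<close> in the sum of the others. Thus the vectors \<open>y\<close>, indexed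
  by the pairs \<open>(y, z)\<close> and measured by \<open>\<parallel>y - z\<parallel>\<close>, are weakly bounded.\<close>

lemma complement_imp_inclination_pos:
  assumes "orth_compl ip (H i) + others_compl i = UNIV"
  shows "inclination ip (H i) (\<Sum>j\<in>UNIV - {i}. H j) > 0"
proof -
  let ?Z = "\<Sum>j\<in>UNIV - {i}. H j"
  have "\<exists>K. \<forall>p\<in>H i \<times> ?Z. norm (ip (fst p) h) \<le> K * nrm (fst p - snd p)" for h
  proof -
    have "h \<in> orth_compl ip (H i) + others_compl i" using assms by simp
    then obtain u v where uv: "h = u + v" "u \<in> orth_compl ip (H i)" "v \<in> others_compl i"
      by (rule set_plus_elim)
    have "norm (ip y h) \<le> nrm v * nrm (y - z)" if y: "y \<in> H i" and z: "z \<in> ?Z" for y z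
    proof -
      obtain x where zx: "z = sum x (UNIV - {i})" and x: "\<forall>j\<in>UNIV - {i}. x j \<in> H j"
        using z unfolding mem_sum_iff by blast
      have "ip (x j) v = 0" if "j \<in> UNIV - {i}" for j
        using x uv(3) that ip_eq_0_commute by (fastforce simp: orth_compl_def)
      then have "ip z v = 0" by (simp add: zx ip_sum_left)
      moreover have "ip y u = 0" using uv(2) y ip_eq_0_commute by (auto simp: orth_compl_def)
      ultimately have "ip y h = ip (y - z) v" by (simp add: uv(1) ip_add_right ip_diff_left)
      then show ?thesis using Cauchy_Schwarz[of "y - z" v] by (simp add: mult.commute)
    qed
    then show ?thesis by (intro exI[of _ "nrm v"]) auto
  qed
  then obtain C where C: "C > 0" "\<And>p. p \<in> H i \<times> ?Z \<Longrightarrow> nrm (fst p) \<le> C * nrm (fst p - snd p)"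
    using uniform_boundedness_family[of "H i \<times> ?Z" "\<lambda>p. nrm (fst p - snd p)" fst] nrm_nonneg
    by blast
  have "1 / C * nrm y \<le> nrm (y - z)" if "y \<in> H i" "z \<in> ?Z" for y z
    using C(2)[of "(y, z)"] C(1) that by (simp add: field_simps)
  then show ?thesis unfolding inclination_pos_iff[OF sub sub_Sum]
    using C(1) by (metis zero_less_divide_1_iff)
qed

text \<open>The sum of all \<open>x j\<close> is the difference of \<open>x i\<close> and a vector of the sum of the other subspaces, so
  the inclination at \<open>i\<close> controls \<open>x i\<close> by the sum.\<close>

lemma inclination_pos_imp_sum_bounded_below:
  assumes "\<And>i. inclination ip (H i) (\<Sum>j\<in>UNIV - {i}. H j) > 0"
  shows "sum_bounded_below ip H"
proof -
  have "\<exists>c>0. \<forall>y\<in>H i. \<forall>z\<in>(\<Sum>j\<in>UNIV - {i}. H j). c * nrm y \<le> nrm (y - z)" for i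
    using assms[of i] unfolding inclination_pos_iff[OF sub sub_Sum] .
  then obtain c where c: "\<And>i. c i > 0"
    and b: "\<And>i y z. y \<in> H i \<Longrightarrow> z \<in> (\<Sum>j\<in>UNIV - {i}. H j) \<Longrightarrow> c i * nrm y \<le> nrm (y - z)" by metis
  show ?thesis
  proof (rule sum_bounded_belowI)
    fix x i assume x: "\<forall>i. x i \<in> H i"
    have "(\<Sum>j\<in>UNIV - {i}. - x j) \<in> (\<Sum>j\<in>UNIV - {i}. H j)"
      unfolding mem_sum_iff using x subspace_neg[OF sub] by (intro exI[of _ "\<lambda>j. - x j"]) auto
    from b[OF _ this, of "x i"] x
    have "c i * nrm (x i) \<le> nrm (x i + (\<Sum>j\<in>UNIV - {i}. x j))" by (simp add: sum_negf)
    then show "nrm (x i) \<le> 1 / c i * nrm (\<Sum>i\<in>UNIV. x i)"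
      using c[of i] by (simp add: sum.remove[of UNIV i] field_simps)
  qed
qed

section \<open>The summation map and its adjoint\<close>

lemmas inner_dsum = inner_product_space_dsum(1)[OF inner_product_space_axioms]
lemmas hilbert_dsum = hilbert_space_dsum[OF hilbert_space_axioms]
lemmas closed_dsum = closed_subspace_direct_sum[OF inner_product_space_axioms closed]

lemma sum_bounded_below_iff:
  "sum_bounded_below ip H \<longleftrightarrow> (\<exists>c>0. \<forall>z\<in>direct_sum H.
      c * ip_norm (dsum_ip ip) z \<le> nrm (\<Sum>i\<in>UNIV. z $ i))"
proof -
  have "(\<forall>x. (\<forall>i. x i \<in> H i) \<longrightarrow> c * sqrt (\<Sum>i\<in>UNIV. (nrm (x i))\<^sup>2) \<le> nrm (\<Sum>i\<in>UNIV. x i))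
      \<longleftrightarrow> (\<forall>z\<in>direct_sum H. c * ip_norm (dsum_ip ip) z \<le> nrm (\<Sum>i\<in>UNIV. z $ i))" (is "?L \<longleftrightarrow> ?R") for c
  proof
    assume R: ?R
    show ?L
    proof (intro allI impI)
      fix x assume "\<forall>i. x i \<in> H i"
      then show "c * sqrt (\<Sum>i\<in>UNIV. (nrm (x i))\<^sup>2) \<le> nrm (\<Sum>i\<in>UNIV. x i)"
        using R[rule_format, of "\<chi> i. x i"] by (simp add: dsum_norm_eq direct_sum_def)
    qed
  qed (simp add: dsum_norm_eq direct_sum_def)
  then show ?thesis unfolding sum_bounded_below_def by blast
qed

lemma nrm_sum_le_dsum_norm: "nrm (\<Sum>i\<in>UNIV. z $ i) \<le> real CARD('n) * ip_norm (dsum_ip ip) (z :: 'a ^ 'n)"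
  using nrm_sum_le[of "\<lambda>i. z $ i" UNIV] sum_nrm_le_dsum_norm[of z] by linarith

lemma sum_image_direct_sum: "(\<lambda>z. \<Sum>i\<in>UNIV. z $ i) ` direct_sum H = (\<Sum>i\<in>UNIV. H i)"
proof (intro set_eqI iffI)
  fix m assume "m \<in> (\<Sum>i\<in>UNIV. H i)"
  then obtain x where x: "\<forall>i\<in>UNIV. x i \<in> H i" "m = sum x UNIV" unfolding mem_sum_iff by blast
  then have "(\<chi> i. x i) \<in> direct_sum H" "m = (\<Sum>i\<in>UNIV. (\<chi> i. x i) $ i)"
    by (simp_all add: direct_sum_def)
  then show "m \<in> (\<lambda>z. \<Sum>i\<in>UNIV. z $ i) ` direct_sum H" by blast
qed (auto simp: direct_sum_def set_sum_alt)

lemma sum_bounded_below_imp_closed_sum: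
  assumes "sum_bounded_below ip H"
  shows "closed_subspace smul ip (\<Sum>i\<in>UNIV. H i)"
proof -
  obtain c where c: "c > 0"
    "\<And>z. z \<in> direct_sum H \<Longrightarrow> c * ip_norm (dsum_ip ip) z \<le> nrm (\<Sum>i\<in>UNIV. z $ i)"
    using assms unfolding sum_bounded_below_iff by blast
  have "closed_subspace smul ip ((\<lambda>z. \<Sum>i\<in>UNIV. z $ i) ` direct_sum H)"
    by (rule closed_subspace_image[OF hilbert_dsum inner_product_space_axioms closed_dsum _ _
          nrm_sum_le_dsum_norm c(2,1)])
      (simp_all add: sum.distrib dsum_scale_def scale_sum_right)
  then show ?thesis unfolding sum_image_direct_sum .
qed

lemma sum_bounded_below_imp_independent:
  assumes "sum_bounded_below ip H"
  shows "lin_independent_subspaces H"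
  unfolding lin_independent_subspaces_def
proof (intro allI impI, elim conjE)
  fix x i assume x: "\<forall>i. x i \<in> H i" and s: "(\<Sum>i\<in>UNIV. x i) = 0"
  obtain c where c: "c > 0"
    "\<And>z. z \<in> direct_sum H \<Longrightarrow> c * ip_norm (dsum_ip ip) z \<le> nrm (\<Sum>i\<in>UNIV. z $ i)"
    using assms unfolding sum_bounded_below_iff by blast
  have "c * ip_norm (dsum_ip ip) (\<chi> i. x i) \<le> 0"
    using c(2)[of "\<chi> i. x i"] x s by (simp add: direct_sum_def)
  then have "ip_norm (dsum_ip ip) (\<chi> i. x i) \<le> 0" using c(1) by (simp add: mult_le_0_iff)
  then have "nrm (x i) \<le> 0" using nrm_component_le[of "\<chi> i. x i" i] by simp
  then show "x i = 0" using nrm_nonneg[of "x i"] nrm_eq_0_iff[of "x i"] by linarith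
qed

text \<open>\<open>T\<close> is the adjoint of the summation map. For every \<open>h\<close>, the functional \<open>\<langle>m, h\<rangle>\<close> on the sum only
  depends on the projection of \<open>h\<close> to the sum, which is the image of some tuple \<open>x\<close>; hence it is
  bounded by \<open>\<parallel>x\<parallel> \<parallel>T m\<parallel>\<close>, and uniform boundedness gives \<open>\<parallel>m\<parallel> \<le> C \<parallel>T m\<parallel>\<close>. So \<open>T\<close> has closed range on
  the sum. A tuple orthogonal to this range has a sum that is orthogonal to itself, hence is zero by
  independence.\<close>

lemma independent_closed_imp_IBAP:
  assumes ind: "lin_independent_subspaces H"
    and M: "closed_subspace smul ip (\<Sum>i\<in>UNIV. H i)" (is "closed_subspace smul ip ?M")
  shows "IBAP ip H"
proof -
  interpret D: hilbert_space "dsum_scale smul" "dsum_ip ip :: 'a ^ 'n \<Rightarrow> _" by (rule hilbert_dsum)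
  define T where "T m = (\<chi> k. P k m)" for m :: 'a
  have TD: "T m \<in> direct_sum H" for m by (simp add: T_def direct_sum_def P_mem)
  have adj: "dsum_ip ip y (T m) = ip (\<Sum>i\<in>UNIV. y $ i) m" if "y \<in> direct_sum H" for y m
    using that by (simp add: dsum_ip_def T_def direct_sum_def ip_sum_left ip_orth_proj_right[OF closed])
  have "\<exists>K. \<forall>m\<in>?M. norm (ip m h) \<le> K * D.nrm (T m)" for h
  proof -
    obtain x where x: "\<forall>i\<in>UNIV. x i \<in> H i" and hx: "orth_proj ip ?M h = sum x UNIV"
      using orth_proj_mem[OF M, of h] unfolding mem_sum_iff by blast
    have "norm (ip m h) \<le> D.nrm (\<chi> i. x i) * D.nrm (T m)" if m: "m \<in> ?M" for m
    proof -
      have z: "(\<chi> i. x i) \<in> direct_sum H" using x by (simp add: direct_sum_def)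
      have "ip (orth_proj ip ?M h) m = dsum_ip ip (\<chi> i. x i) (T m)" by (simp add: adj[OF z] hx)
      then have "ip h m = dsum_ip ip (\<chi> i. x i) (T m)" by (simp add: ip_orth_proj_left[OF M m])
      then show ?thesis
        using D.Cauchy_Schwarz[of "\<chi> i. x i" "T m"] ip_cnj[of m h] by (simp add: norm_scalar_cnj)
    qed
    then show ?thesis by blast
  qed
  then obtain C where C: "C > 0" "\<And>m. m \<in> ?M \<Longrightarrow> nrm m \<le> C * D.nrm (T m)"
    using uniform_boundedness_family[of ?M "\<lambda>m. D.nrm (T m)" "\<lambda>m. m"] D.nrm_nonneg by blast
  have "closed_subspace (dsum_scale smul) (dsum_ip ip) (T ` ?M)"
  proof (rule closed_subspace_image[OF hilbert_space_axioms D.inner_product_space_axioms M])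
    show "T (x + y) = T x + T y" for x y by (simp add: T_def vec_eq_iff P_add)
    show "T (smul c x) = dsum_scale smul c (T x)" for c x
      by (simp add: T_def vec_eq_iff dsum_scale_def P_scale)
    have "(\<Sum>i\<in>UNIV. nrm (P i m)) \<le> real CARD('n) * nrm m" for m
      using sum_bounded_above[of UNIV "\<lambda>i. nrm (P i m)" "nrm m", OF nrm_orth_proj_le[OF closed]] by simp
    then show "D.nrm (T m) \<le> real CARD('n) * nrm m" for m
      using dsum_norm_le_sum[of "T m"] by (simp add: T_def) (meson order_trans)
    show "1 / C * nrm m \<le> D.nrm (T m)" if "m \<in> ?M" for m
      using C(2)[OF that] C(1) by (simp add: field_simps)
    show "1 / C > 0" using C(1) by simp
  qed
  then have onto: "T ` ?M = direct_sum H"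
  proof (rule D.closed_subspace_eqI)
    show "D.subspace (direct_sum H)" using D.closed_subspaceD(1)[OF closed_dsum] .
    show "T ` ?M \<subseteq> direct_sum H" using TD by blast
    fix y assume y: "y \<in> direct_sum H" and perp: "\<And>z. z \<in> T ` ?M \<Longrightarrow> dsum_ip ip y z = 0"
    have "(\<Sum>i\<in>UNIV. y $ i) \<in> ?M" using y unfolding sum_image_direct_sum[symmetric] by blast
    then have "ip (\<Sum>i\<in>UNIV. y $ i) (\<Sum>i\<in>UNIV. y $ i) = 0" using perp adj[OF y] by fastforce
    then have "(\<Sum>i\<in>UNIV. y $ i) = 0" by (simp add: ip_self)
    then show "y = 0"
      using ind y unfolding lin_independent_subspaces_def direct_sum_def vec_eq_iff by auto
  qed
  show ?thesis
    unfolding IBAP_def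
  proof (intro allI impI)
    fix x assume "\<forall>k. x k \<in> H k"
    then have "(\<chi> k. x k) \<in> T ` ?M" unfolding onto by (simp add: direct_sum_def)
    then obtain m where "(\<chi> k. x k) = T m" by blast
    then have "\<forall>k. P k m = x k" by (simp add: T_def vec_eq_iff)
    then show "\<exists>y. \<forall>k. P k y = x k" by blast
  qed
qed

section \<open>The Gram operator\<close>

text \<open>The Gram operator is the summation map followed by its adjoint. Hence, if it is onto, so is the
  adjoint, and this is the IBAP.\<close>

lemma gram_component: "gram_operator ip H z $ i = P i (\<Sum>j\<in>UNIV. z $ j)"
  by (simp add: gram_operator_def P_sum)

lemma gram_isomorphism_imp_IBAP:
  assumes "hilbert_isomorphism (dsum_scale smul) (dsum_ip ip) (direct_sum H)
      (dsum_scale smul) (dsum_ip ip) (direct_sum H) (gram_operator ip H)"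
  shows "IBAP ip H"
  unfolding IBAP_def
proof (intro allI impI)
  fix x assume "\<forall>k. x k \<in> H k"
  then have "(\<chi> k. x k) \<in> direct_sum H" by (simp add: direct_sum_def)
  moreover have "gram_operator ip H ` direct_sum H = direct_sum H"
    using assms by (simp add: hilbert_isomorphism_def bij_betw_def)
  ultimately have "(\<chi> k. x k) \<in> gram_operator ip H ` direct_sum H" by simp
  then obtain z where "(\<chi> k. x k) = gram_operator ip H z" by blast
  then have "\<forall>k. P k (\<Sum>j\<in>UNIV. z $ j) = x k"
    unfolding gram_component[symmetric] by (metis vec_lambda_beta)
  then show "\<exists>y. \<forall>k. P k y = x k" by blast
qed

text \<open>Since \<open>\<langle>z, G z\<rangle> = \<parallel>\<Sum>i. z $ i\<parallel>\<^sup>2\<close>, a lower bound \<open>c\<close> for the summation map gives the lower bound \<open>c\<^sup>2\<close> for the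
  Gram operator \<open>G\<close>. Its range is therefore closed, and a vector \<open>y\<close> orthogonal to the range satisfies
  \<open>\<langle>y, G y\<rangle> = 0\<close>, so \<open>y = 0\<close>.\<close>

lemma sum_bounded_below_imp_gram_isomorphism:
  assumes "sum_bounded_below ip H"
  shows "hilbert_isomorphism (dsum_scale smul) (dsum_ip ip) (direct_sum H)
      (dsum_scale smul) (dsum_ip ip) (direct_sum H) (gram_operator ip H)"
proof -
  interpret D: hilbert_space "dsum_scale smul" "dsum_ip ip :: 'a ^ 'n \<Rightarrow> _" by (rule hilbert_dsum)
  note sD = D.closed_subspaceD(1)[OF closed_dsum]
  let ?G = "gram_operator ip H" and ?n = "real CARD('n)"
  obtain c where c: "c > 0"
    "\<And>z. z \<in> direct_sum H \<Longrightarrow> c * D.nrm z \<le> nrm (\<Sum>i\<in>UNIV. z $ i)"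
    using assms unfolding sum_bounded_below_iff by blast
  have GD: "?G z \<in> direct_sum H" for z by (simp add: direct_sum_def gram_component P_mem)
  have add: "?G (x + y) = ?G x + ?G y" for x y
    by (simp add: vec_eq_iff gram_component sum.distrib P_add)
  have hom: "?G (dsum_scale smul a x) = dsum_scale smul a (?G x)" for a x
    by (simp add: vec_eq_iff gram_component dsum_scale_def scale_sum_right[symmetric] P_scale)
  have quad: "dsum_ip ip z (?G w) = ip (\<Sum>i\<in>UNIV. z $ i) (\<Sum>j\<in>UNIV. w $ j)" if "z \<in> direct_sum H" for z w
    using that by (simp add: dsum_ip_def gram_component direct_sum_def ip_sum_left[of "\<lambda>i. z $ i"]
        ip_orth_proj_right[OF closed])
  have above: "D.nrm (?G z) \<le> ?n * ?n * D.nrm z" for z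
  proof -
    have "D.nrm (?G z) \<le> (\<Sum>i\<in>UNIV. nrm (?G z $ i))" by (rule dsum_norm_le_sum)
    also have "\<dots> \<le> ?n * nrm (\<Sum>j\<in>UNIV. z $ j)"
      unfolding gram_component
      using sum_bounded_above[of UNIV "\<lambda>i. nrm (P i (\<Sum>j\<in>UNIV. z $ j))", OF nrm_orth_proj_le[OF closed]]
      by simp
    also have "\<dots> \<le> ?n * (?n * D.nrm z)" by (intro mult_left_mono nrm_sum_le_dsum_norm) simp
    finally show ?thesis by simp
  qed
  have below: "c\<^sup>2 * D.nrm z \<le> D.nrm (?G z)" if z: "z \<in> direct_sum H" for z
  proof (cases "z = 0")
    case False
    then have p: "D.nrm z > 0" by (rule D.nrm_pos)
    have "(c * D.nrm z)\<^sup>2 \<le> (nrm (\<Sum>i\<in>UNIV. z $ i))\<^sup>2" using c z by (intro power_mono) auto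
    also have "\<dots> = norm (dsum_ip ip z (?G z))" by (simp add: quad[OF z] norm_ip_self)
    also have "\<dots> \<le> D.nrm z * D.nrm (?G z)" by (rule D.Cauchy_Schwarz)
    finally have "D.nrm z * (c\<^sup>2 * D.nrm z) \<le> D.nrm z * D.nrm (?G z)"
      by (simp add: power2_eq_square algebra_simps)
    then show ?thesis using p by simp
  qed simp
  have "closed_subspace (dsum_scale smul) (dsum_ip ip) (?G ` direct_sum H)"
    by (rule closed_subspace_image[OF hilbert_dsum inner_dsum closed_dsum add hom above below])
      (use c in simp_all)
  then have "?G ` direct_sum H = direct_sum H"
  proof (rule D.closed_subspace_eqI[OF _ sD])
    show "?G ` direct_sum H \<subseteq> direct_sum H" using GD by blast
    fix y assume y: "y \<in> direct_sum H" and perp: "\<And>z. z \<in> ?G ` direct_sum H \<Longrightarrow> dsum_ip ip y z = 0"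
    have "ip (\<Sum>i\<in>UNIV. y $ i) (\<Sum>i\<in>UNIV. y $ i) = 0" using perp[of "?G y"] y quad[OF y] by simp
    then have "c * D.nrm y \<le> 0" using c(2)[OF y] by (simp add: ip_self)
    then have "D.nrm y = 0" using c(1) D.nrm_nonneg[of y] by (simp add: mult_le_0_iff)
    then show "y = 0" by simp
  qed
  then show ?thesis
    by (rule hilbert_isomorphismI[OF inner_dsum inner_dsum sD sD _ add hom above below])
      (use c in simp_all)
qed

end

section \<open>Families of mutually annihilating projections\<close>

lemma (in inner_product_space) continuous_projection_iff:
  "continuous_projection smul ip E \<longleftrightarrow>
    (\<forall>x y. E (x + y) = E x + E y) \<and> (\<forall>c x. E (smul c x) = smul c (E x)) \<and>
    (\<exists>C. \<forall>x. nrm (E x) \<le> C * nrm x) \<and> (\<forall>x. E (E x) = E x)" (is "_ \<longleftrightarrow> ?R")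
proof -
  have lin: "Vector_Spaces.linear smul smul E \<longleftrightarrow>
      (\<forall>x y. E (x + y) = E x + E y) \<and> (\<forall>c x. E (smul c x) = smul c (E x))"
    by (simp add: Vector_Spaces.linear_iff vector_space_axioms)
  have cont: "continuous_map (ip_topology ip) (ip_topology ip) E \<longleftrightarrow> (\<exists>C. \<forall>x. nrm (E x) \<le> C * nrm x)"
    if "\<forall>x y. E (x + y) = E x + E y" "\<forall>c x. E (smul c x) = smul c (E x)"
  proof -
    have "continuous_map (subtopology (ip_topology ip) UNIV) (subtopology (ip_topology ip) UNIV) E
        \<longleftrightarrow> (\<exists>C. \<forall>x\<in>UNIV. nrm (E x) \<le> C * nrm x)"
      by (rule continuous_linear_iff_bounded[OF inner_product_space_axioms inner_product_space_axioms])
        (simp_all add: that)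
    then show ?thesis by simp
  qed
  show ?thesis
    unfolding continuous_projection_def lin using cont by (auto simp: fun_eq_iff)
qed

context subspace_system
begin

text \<open>\<open>E k h\<close> is the component in \<open>H k\<close> of the orthogonal projection of \<open>h\<close> to the closed sum. The lower
  bound for the summation map bounds the components by the sum.\<close>

lemma sum_bounded_below_imp_projections:
  assumes "sum_bounded_below ip H"
  shows "\<exists>E. (\<forall>k. continuous_projection smul ip (E k)) \<and>
      (\<forall>i j. i \<noteq> j \<longrightarrow> E i \<circ> E j = (\<lambda>x. 0)) \<and> (\<forall>k. range (E k) = H k)"
proof -
  let ?M = "\<Sum>i\<in>UNIV. H i"
  note M = sum_bounded_below_imp_closed_sum[OF assms]
  obtain c where c: "c > 0"
    "\<And>z. z \<in> direct_sum H \<Longrightarrow> c * ip_norm (dsum_ip ip) z \<le> nrm (\<Sum>i\<in>UNIV. z $ i)"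
    using assms unfolding sum_bounded_below_iff by blast
  have "\<exists>x. (\<forall>i. x i \<in> H i) \<and> (\<Sum>i\<in>UNIV. x i) = m" if "m \<in> ?M" for m
    using that unfolding mem_sum_iff by blast
  then obtain s where s: "\<And>m i. m \<in> ?M \<Longrightarrow> s m i \<in> H i" "\<And>m. m \<in> ?M \<Longrightarrow> (\<Sum>i\<in>UNIV. s m i) = m"
    by metis
  have sM: "(\<Sum>i\<in>UNIV. x i) \<in> ?M" if "\<And>i. x i \<in> H i" for x
    using that unfolding mem_sum_iff by blast
  have s_eq: "s (\<Sum>i\<in>UNIV. x i) k = x k" if x: "\<And>i. x i \<in> H i" for x k
  proof -
    let ?m = "\<Sum>i\<in>UNIV. x i"
    have "\<forall>i. s ?m i - x i \<in> H i" using s(1)[OF sM[OF x]] x subspace_diff[OF sub] by blast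
    moreover have "(\<Sum>i\<in>UNIV. s ?m i - x i) = 0" by (simp add: sum_subtractf s(2)[OF sM[OF x]])
    ultimately have "\<forall>i. s ?m i - x i = 0"
      using sum_bounded_below_imp_independent[OF assms, unfolded lin_independent_subspaces_def,
          rule_format, of "\<lambda>i. s ?m i - x i"] by blast
    then show ?thesis by simp
  qed
  have s_add: "s (m + m') k = s m k + s m' k" if "m \<in> ?M" "m' \<in> ?M" for m m' k
    using s_eq[of "\<lambda>i. s m i + s m' i" k] subspace_add[OF sub] s that by (simp add: sum.distrib)
  have s_scale: "s (smul a m) k = smul a (s m k)" if "m \<in> ?M" for a m k
    using s_eq[of "\<lambda>i. smul a (s m i)" k] subspace_scale[OF sub] s that
    by (simp add: scale_sum_right[symmetric])
  have s_single: "s x k = (if k = j then x else 0)" and mem_single: "x \<in> ?M" if "x \<in> H j" for x j k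
  proof -
    have *: "(if i = j then x else 0) \<in> H i" for i using that subspace_0[OF sub] by simp
    have **: "(\<Sum>i\<in>UNIV. if i = j then x else 0) = x" by simp
    show "s x k = (if k = j then x else 0)" "x \<in> ?M"
      using s_eq[OF *] sM[OF *] unfolding ** by simp_all
  qed
  define E where "E k h = s (orth_proj ip ?M h) k" for k h
  note QM = orth_proj_mem[OF M]
  have E_H: "E k h \<in> H k" for k h unfolding E_def by (rule s(1)[OF QM])
  have E_on_H: "E k x = (if k = j then x else 0)" if "x \<in> H j" for k j x
    using s_single[OF that] mem_single[OF that] by (simp add: E_def orth_proj_fixed[OF M])
  have "continuous_projection smul ip (E k)" for k
    unfolding continuous_projection_iff
  proof (intro conjI allI exI)
    show "E k (x + y) = E k x + E k y" for x y
      unfolding E_def orth_proj_add[OF M] by (rule s_add[OF QM QM])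
    show "E k (smul a x) = smul a (E k x)" for a x
      unfolding E_def orth_proj_scale[OF M] by (rule s_scale[OF QM])
    show "E k (E k x) = E k x" for x using E_on_H[OF E_H[of k x]] by simp
    show "nrm (E k h) \<le> 1 / c * nrm h" for h
    proof -
      let ?z = "\<chi> i. E i h"
      have "c * nrm (E k h) \<le> c * ip_norm (dsum_ip ip) ?z"
        using c(1) nrm_component_le[of ?z k] by simp
      also have "\<dots> \<le> nrm (\<Sum>i\<in>UNIV. ?z $ i)" by (rule c(2)) (simp add: direct_sum_def E_H)
      also have "(\<Sum>i\<in>UNIV. ?z $ i) = orth_proj ip ?M h" by (simp add: E_def s(2)[OF QM])
      also have "nrm \<dots> \<le> nrm h" by (rule nrm_orth_proj_le[OF M])
      finally show ?thesis using c(1) by (simp add: field_simps)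
    qed
  qed
  moreover have "E i \<circ> E j = (\<lambda>x. 0)" if "i \<noteq> j" for i j
    using E_on_H[OF E_H[of j], of i] that by (simp add: fun_eq_iff)
  moreover have "range (E k) = H k" for k
  proof
    show "H k \<subseteq> range (E k)" using E_on_H[of _ k k] by (metis rangeI subsetI)
  qed (use E_H in blast)
  ultimately show ?thesis by blast
qed

text \<open>With \<open>R\<close> the projection complementary to the sum of the \<open>E k\<close>, the new inner product is
  \<open>\<Sum>\<langle>E k x, E k y\<rangle> + \<langle>R x, R y\<rangle>\<close>. It is equivalent to the old one because every \<open>x\<close> is the sum of
  the \<open>E k x\<close> and \<open>R x\<close>, and all these maps are bounded.\<close>

lemma projections_imp_orthogonal_inner_product:
  assumes E: "\<And>k. continuous_projection smul ip (E k)"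
    and EE: "\<And>i j. i \<noteq> j \<Longrightarrow> E i \<circ> E j = (\<lambda>x. 0)" and ran: "\<And>k. range (E k) = H k"
  shows "\<exists>ip0. inner_product_space smul ip0 \<and> equivalent_inner_products ip ip0 \<and>
      pairwise_orthogonal ip0 H"
proof -
  have E_add: "E k (x + y) = E k x + E k y" and E_scale: "E k (smul a x) = smul a (E k x)"
    and E_idem: "E k (E k x) = E k x" and "\<exists>C. \<forall>x. nrm (E k x) \<le> C * nrm x" for k x y a
    using E unfolding continuous_projection_iff by blast+
  then obtain C where C: "\<And>k x. nrm (E k x) \<le> C k * nrm x" by metis
  have E_on_H: "E k x = (if k = i then x else 0)" if "x \<in> H i" for k i x
  proof -
    have "x \<in> range (E i)" using that by (simp only: ran)
    then obtain y where "x = E i y" by (rule rangeE)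
    then show ?thesis using E_idem EE[of k i] by (auto simp: fun_eq_iff)
  qed
  define R where "R x = x - (\<Sum>k\<in>UNIV. E k x)" for x
  have R_add: "R (x + y) = R x + R y" and R_scale: "R (smul a x) = smul a (R x)" for x y a
    by (simp_all add: R_def E_add E_scale sum.distrib scale_right_diff_distrib scale_sum_right)
  have R_on_H: "R x = 0" if "x \<in> H i" for i x
    by (simp add: R_def E_on_H[OF that])
  define ip0 where "ip0 x y = (\<Sum>k\<in>UNIV. ip (E k x) (E k y)) + ip (R x) (R y)" for x y
  define q where "q x = (\<Sum>k\<in>UNIV. (nrm (E k x))\<^sup>2) + (nrm (R x))\<^sup>2" for x
  have q0: "q x \<ge> 0" for x by (simp add: q_def sum_nonneg)
  have self: "ip0 x x = of_real (q x)" for x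
    by (simp add: ip0_def q_def ip_self)
  have nrm0: "ip_norm ip0 x = sqrt (q x)" for x
    by (simp add: ip_norm_def self q0)
  have lower: "nrm x \<le> (real CARD('n) + 1) * sqrt (q x)" for x
  proof -
    have "nrm (E k x) \<le> sqrt (q x)" for k
      by (rule real_le_rsqrt)
        (auto simp: q_def intro!: add_increasing2 member_le_sum[of k UNIV "\<lambda>k. (nrm (E k x))\<^sup>2"])
    then have "(\<Sum>k\<in>UNIV. nrm (E k x)) \<le> real CARD('n) * sqrt (q x)"
      using sum_bounded_above[of UNIV "\<lambda>k. nrm (E k x)"] by simp
    moreover have "nrm (R x) \<le> sqrt (q x)" by (rule real_le_rsqrt) (simp add: q_def sum_nonneg)
    moreover have "nrm x \<le> (\<Sum>k\<in>UNIV. nrm (E k x)) + nrm (R x)"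
      using nrm_triangle[of "\<Sum>k\<in>UNIV. E k x" "R x"] nrm_sum_le[of "\<lambda>k. E k x" UNIV]
      by (simp add: R_def)
    ultimately show ?thesis by (simp add: algebra_simps)
  qed
  define B where "B = (\<Sum>k\<in>UNIV. \<bar>C k\<bar>)"
  have B0: "B \<ge> 0" by (simp add: B_def sum_nonneg)
  have sumE: "(\<Sum>k\<in>UNIV. nrm (E k x)) \<le> B * nrm x" for x
    unfolding B_def sum_distrib_right
    by (intro sum_mono order_trans[OF C] mult_right_mono) simp_all
  have upper: "sqrt (q x) \<le> (2 * B + 1) * nrm x" for x
  proof -
    have "sqrt (q x) \<le> sqrt (\<Sum>k\<in>UNIV. (nrm (E k x))\<^sup>2) + nrm (R x)"
      using sqrt_add_le_add_sqrt[of "\<Sum>k\<in>UNIV. (nrm (E k x))\<^sup>2" "(nrm (R x))\<^sup>2"]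
      by (simp add: q_def sum_nonneg)
    moreover have "sqrt (\<Sum>k\<in>UNIV. (nrm (E k x))\<^sup>2) \<le> (\<Sum>k\<in>UNIV. nrm (E k x))"
      using L2_set_le_sum[of UNIV "\<lambda>k. nrm (E k x)"] by (simp add: L2_set_def)
    moreover have "nrm (R x) \<le> nrm x + (\<Sum>k\<in>UNIV. nrm (E k x))"
      using nrm_triangle[of x "- (\<Sum>k\<in>UNIV. E k x)"] nrm_sum_le[of "\<lambda>k. E k x" UNIV]
      by (simp add: R_def nrm_minus)
    ultimately have "sqrt (q x) \<le> nrm x + 2 * (B * nrm x)" using sumE[of x] by linarith
    then show ?thesis by (simp add: algebra_simps)
  qed
  have "inner_product_space smul ip0"
  proof
    show "ip0 (x + y) z = ip0 x z + ip0 y z" for x y z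
      by (simp add: ip0_def E_add R_add ip_add_left sum.distrib)
    show "ip0 (smul a x) y = a * ip0 x y" for a x y
      by (simp add: ip0_def E_scale R_scale ip_scale_left sum_distrib_left distrib_left)
    show "ip0 y x = scalar_cnj (ip0 x y)" for x y
      unfolding ip0_def scalar_cnj_add scalar_cnj_sum
      by (intro arg_cong2[where f="(+)"] sum.cong refl ip_cnj)
    show "\<exists>r>0. ip0 x x = of_real r" if "x \<noteq> 0" for x
    proof (intro exI conjI)
      have "nrm x > 0" using that by (rule nrm_pos)
      then have "q x \<noteq> 0" using lower[of x] by auto
      then show "q x > 0" using q0[of x] by simp
    qed (rule self)
  qed
  moreover have "equivalent_inner_products ip ip0"
    unfolding equivalent_inner_products_def nrm0
  proof (intro exI conjI allI)
    show "1 / (real CARD('n) + 1) * nrm x \<le> sqrt (q x)" for x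
      using lower[of x] by (simp add: field_simps add_pos_nonneg)
    show "sqrt (q x) \<le> (2 * B + 1) * nrm x" for x by (rule upper)
  qed (use B0 in simp_all)
  moreover have "pairwise_orthogonal ip0 H"
    unfolding pairwise_orthogonal_def
  proof (intro allI impI ballI)
    fix i j x y assume ij: "i \<noteq> j" and x: "x \<in> H i" and y: "y \<in> H j"
    have "ip (E k x) (E k y) = 0" for k
      using ij by (simp add: E_on_H[OF x] E_on_H[OF y])
    then show "ip0 x y = 0" by (simp add: ip0_def R_on_H[OF x])
  qed
  ultimately show ?thesis by blast
qed

section \<open>Orthogonality in an equivalent Hilbert space structure\<close>

text \<open>The space \<open>K\<close> is the space itself with the new inner product, and the isomorphism is the identity:
  equivalent inner products have the same Cauchy sequences and the same limits.\<close>

lemma orthogonal_inner_product_imp_isomorphic: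
  assumes ips0: "inner_product_space smul ip0" and equiv: "equivalent_inner_products ip ip0"
    and orth: "pairwise_orthogonal ip0 H"
  shows "isomorphic_to_orthogonal_system TYPE('a) smul ip H"
proof -
  interpret Z: inner_product_space smul ip0 by fact
  obtain c C where c: "c > 0" and C: "C > 0"
    and lo: "\<And>x. c * nrm x \<le> Z.nrm x" and up: "\<And>x. Z.nrm x \<le> C * nrm x"
    using equiv unfolding equivalent_inner_products_def by blast
  have lo': "nrm x \<le> 1 / c * Z.nrm x" for x using lo[of x] c by (simp add: field_simps)
  have lim: "(\<lambda>n. nrm (f n - l)) \<longlonglongrightarrow> 0 \<longleftrightarrow> (\<lambda>n. Z.nrm (f n - l)) \<longlonglongrightarrow> 0" for f l
  proof
    assume a: "(\<lambda>n. nrm (f n - l)) \<longlonglongrightarrow> 0"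
    show "(\<lambda>n. Z.nrm (f n - l)) \<longlonglongrightarrow> 0"
    proof (rule tendsto_sandwich)
      show "\<forall>\<^sub>F n in sequentially. 0 \<le> Z.nrm (f n - l)" by simp
      show "\<forall>\<^sub>F n in sequentially. Z.nrm (f n - l) \<le> C * nrm (f n - l)" using up by simp
      show "(\<lambda>n. C * nrm (f n - l)) \<longlonglongrightarrow> 0" using tendsto_mult[OF tendsto_const a, of C] by simp
    qed simp
  next
    assume a: "(\<lambda>n. Z.nrm (f n - l)) \<longlonglongrightarrow> 0"
    show "(\<lambda>n. nrm (f n - l)) \<longlonglongrightarrow> 0"
    proof (rule tendsto_sandwich)
      show "\<forall>\<^sub>F n in sequentially. 0 \<le> nrm (f n - l)" by simp
      show "\<forall>\<^sub>F n in sequentially. nrm (f n - l) \<le> 1 / c * Z.nrm (f n - l)" using lo' by simp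
      show "(\<lambda>n. 1 / c * Z.nrm (f n - l)) \<longlonglongrightarrow> 0"
        using tendsto_mult[OF tendsto_const a, of "1 / c"] by simp
    qed simp
  qed
  have hilbert0: "hilbert_space smul ip0"
  proof (rule hilbert_spaceI[OF ips0])
    fix f assume f: "Z.cauchy_seq f"
    have "cauchy_seq f"
      unfolding cauchy_seq_def
    proof (intro allI impI)
      fix e :: real assume "e > 0"
      then obtain M where M: "\<And>m n. m \<ge> M \<Longrightarrow> n \<ge> M \<Longrightarrow> Z.nrm (f m - f n) < c * e"
        using f c unfolding Z.cauchy_seq_def by (metis mult_pos_pos)
      have "nrm (f m - f n) < e" if "m \<ge> M" "n \<ge> M" for m n
      proof -
        have "c * nrm (f m - f n) < c * e" using lo M[OF that] by (rule le_less_trans)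
        then show ?thesis using c by simp
      qed
      then show "\<exists>M. \<forall>m\<ge>M. \<forall>n\<ge>M. nrm (f m - f n) < e" by blast
    qed
    then obtain l where "(\<lambda>n. nrm (f n - l)) \<longlonglongrightarrow> 0" by (rule cauchy_seq_converges)
    then show "\<exists>l. (\<lambda>n. Z.nrm (f n - l)) \<longlonglongrightarrow> 0" unfolding lim by blast
  qed
  have "closed_subspace smul ip0 (H i)" for i
    using closed[of i] unfolding closed_subspace_def closedin_iff_nrm Z.closedin_iff_nrm lim .
  moreover have "hilbert_isomorphism smul ip UNIV smul ip0 UNIV (\<lambda>x. x)"
    by (rule hilbert_isomorphismI[OF inner_product_space_axioms ips0, where C=C and c=c])
      (simp_all add: up lo c)
  then have "isomorphic_systems smul ip H smul ip0 H"
    unfolding isomorphic_systems_def by (intro exI[of _ "\<lambda>x. x"]) simp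
  ultimately show ?thesis
    unfolding isomorphic_to_orthogonal_system_def using hilbert0 orth by blast
qed

text \<open>In the orthogonal system, \<open>f (x i)\<close> is no longer than the sum of all \<open>f (x j)\<close> by Pythagoras; the
  bounds for the isomorphism and its inverse transport this back. The carrier type of \<open>K\<close> is
  arbitrary, so that any orthogonal model yields one on the type of the given space.\<close>

lemma isomorphic_imp_sum_bounded_below:
  assumes "isomorphic_to_orthogonal_system TYPE('b::ab_group_add) smul ip H"
  shows "sum_bounded_below ip H"
proof -
  obtain s2 :: "'k \<Rightarrow> 'b \<Rightarrow> 'b" and ip2 K f where hs2: "hilbert_space s2 ip2"
    and orth: "pairwise_orthogonal ip2 K"
    and iso: "hilbert_isomorphism smul ip UNIV s2 ip2 UNIV f" and fH: "\<And>i. f ` H i = K i"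
    using assms unfolding isomorphic_to_orthogonal_system_def isomorphic_systems_def by blast
  interpret Y: hilbert_space s2 ip2 by fact
  obtain C where up: "\<And>x. Y.nrm (f x) \<le> C * nrm x" and lo: "\<And>x. nrm x \<le> C * Y.nrm (f x)"
    using hilbert_isomorphism_UNIV_bounds[OF inner_product_space_axioms Y.inner_product_space_axioms iso]
    by blast
  have f_add: "f (x + y) = f x + f y" for x y using iso by (simp add: hilbert_isomorphism_def)
  have f_0: "f 0 = 0" using f_add[of 0 0] by simp
  have f_sum: "f (sum x A) = (\<Sum>i\<in>A. f (x i))" for x and A :: "'n set"
    by (induction A rule: infinite_finite_induct) (simp_all add: f_0 f_add)
  show ?thesis
  proof (rule sum_bounded_belowI)
    fix x i assume x: "\<forall>i. x i \<in> H i"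
    have fK: "f (x j) \<in> K j" for j unfolding fH[symmetric] using x by (intro imageI) simp
    have "ip2 (f (x i)) (f (x j)) = 0" if "i \<noteq> j" for j
      using orth fK[of i] fK[of j] that unfolding pairwise_orthogonal_def by simp
    then have "ip2 (f (x i)) (\<Sum>j\<in>UNIV - {i}. f (x j)) = 0"
      by (simp add: Y.ip_sum_right)
    from Y.nrm_sq_add_orthogonal[OF this]
    have "(Y.nrm (f (x i)))\<^sup>2 \<le> (Y.nrm (f (\<Sum>i\<in>UNIV. x i)))\<^sup>2"
      by (simp add: f_sum f_add sum.remove[of UNIV i])
    then have le: "Y.nrm (f (x i)) \<le> Y.nrm (f (\<Sum>i\<in>UNIV. x i))" by (rule power2_le_imp_le) simp
    have "nrm (x i) \<le> \<bar>C\<bar> * Y.nrm (f (x i))"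
      using lo by (rule order_trans) (intro mult_right_mono, simp_all)
    also have "\<dots> \<le> \<bar>C\<bar> * (\<bar>C\<bar> * nrm (\<Sum>i\<in>UNIV. x i))"
      by (intro mult_left_mono order_trans[OF le] order_trans[OF up] mult_right_mono) simp_all
    finally show "nrm (x i) \<le> C\<^sup>2 * nrm (\<Sum>i\<in>UNIV. x i)"
      by (simp add: power2_eq_square mult.assoc[symmetric])
  qed
qed

end

section \<open>The equivalence\<close>

theorem theorem3p1:
  fixes smul :: "'k::real_or_complex \<Rightarrow> 'a::ab_group_add \<Rightarrow> 'a"
    and ip :: "'a \<Rightarrow> 'a \<Rightarrow> 'k"
    and H :: "'n::finite \<Rightarrow> 'a set"
  assumes "hilbert_space smul ip"
    and "\<And>i. closed_subspace smul ip (H i)"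
  shows "all_equivalent
     [IBAP ip H,
      lin_independent_subspaces H \<and> closedin (ip_topology ip) (\<Sum>i\<in>UNIV. H i),
      Inf {ereal (ip_norm ip (\<Sum>i\<in>UNIV. x i) / sqrt (\<Sum>i\<in>UNIV. (ip_norm ip (x i))\<^sup>2)) | x.
             (\<forall>i. x i \<in> H i) \<and> x \<noteq> (\<lambda>i. 0)} > 0,
      hilbert_isomorphism (dsum_scale smul) (dsum_ip ip) (direct_sum H)
        (dsum_scale smul) (dsum_ip ip) (direct_sum H) (gram_operator ip H),
      isomorphic_to_orthogonal_system TYPE('a) smul ip H,
      \<exists>ip0. inner_product_space smul ip0 \<and> equivalent_inner_products ip ip0 \<and>
        pairwise_orthogonal ip0 H,
      \<exists>E :: 'n \<Rightarrow> 'a \<Rightarrow> 'a. (\<forall>k. continuous_projection smul ip (E k)) \<and>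
        (\<forall>i j. i \<noteq> j \<longrightarrow> E i \<circ> E j = (\<lambda>x. 0)) \<and> (\<forall>k. range (E k) = H k),
      \<forall>i. inclination ip (H i) (\<Sum>j\<in>UNIV - {i}. H j) > 0,
      (\<Sum>i\<in>UNIV. \<Inter>j\<in>UNIV - {i}. orth_compl ip (H j)) = UNIV,
      \<forall>i. orth_compl ip (H i) + (\<Inter>j\<in>UNIV - {i}. orth_compl ip (H j)) = UNIV]
    \<and> (isomorphic_to_orthogonal_system TYPE('b::ab_group_add) smul ip H \<longrightarrow>
        isomorphic_to_orthogonal_system TYPE('a) smul ip H)"
    (is "all_equivalent [?s1, ?s2, ?s3, ?s4, ?s5, ?s6, ?s7, ?s8, ?s9, ?s10] \<and> (?s5b \<longrightarrow> ?s5)")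
proof -
  interpret subspace_system smul ip H
    using assms by (simp add: subspace_system_def subspace_system_axioms_def)
  let ?s = "sum_bounded_below ip H"
  have s3: "?s3 \<longleftrightarrow> ?s" by (rule Inf_quotient_pos_iff)
  have closed_sum: "closed_subspace smul ip (\<Sum>i\<in>UNIV. H i)
      \<longleftrightarrow> closedin (ip_topology ip) (\<Sum>i\<in>UNIV. H i)"
    by (simp add: closed_subspace_def sub_Sum)
  have "?s1 \<Longrightarrow> ?s9" by (rule IBAP_imp_sum_others_compl)
  moreover have "?s9 \<Longrightarrow> ?s10" by (intro allI sum_others_compl_imp_complement)
  moreover have "?s10 \<Longrightarrow> ?s1" by (intro complement_imp_IBAP) blast
  moreover have "?s10 \<Longrightarrow> ?s8" by (intro allI complement_imp_inclination_pos) blast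
  moreover have "?s8 \<Longrightarrow> ?s" by (intro inclination_pos_imp_sum_bounded_below) blast
  moreover have "?s \<Longrightarrow> ?s2"
    using sum_bounded_below_imp_closed_sum sum_bounded_below_imp_independent closed_sum by blast
  moreover have "?s2 \<Longrightarrow> ?s1" using independent_closed_imp_IBAP closed_sum by blast
  moreover have "?s \<Longrightarrow> ?s4" by (rule sum_bounded_below_imp_gram_isomorphism)
  moreover have "?s4 \<Longrightarrow> ?s1" by (rule gram_isomorphism_imp_IBAP)
  moreover have "?s \<Longrightarrow> ?s7" by (rule sum_bounded_below_imp_projections)
  moreover have "?s7 \<Longrightarrow> ?s6" using projections_imp_orthogonal_inner_product by blast
  moreover have "?s6 \<Longrightarrow> ?s5" using orthogonal_inner_product_imp_isomorphic by blast
  moreover have "?s5 \<Longrightarrow> ?s" by (rule isomorphic_imp_sum_bounded_below)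
  moreover have "?s5b \<Longrightarrow> ?s" by (rule isomorphic_imp_sum_bounded_below)
  ultimately have "?s1 \<longleftrightarrow> ?s" "?s2 \<longleftrightarrow> ?s" "?s4 \<longleftrightarrow> ?s" "?s5 \<longleftrightarrow> ?s" "?s6 \<longleftrightarrow> ?s"
    "?s7 \<longleftrightarrow> ?s" "?s8 \<longleftrightarrow> ?s" "?s9 \<longleftrightarrow> ?s" "?s10 \<longleftrightarrow> ?s" "?s5b \<longrightarrow> ?s5"
    by argo+
  then show ?thesis unfolding s3 all_equivalent_def by simp
qed

end
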